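(* Consider a non-critical XOR Ising model, i.e. one with couplings $J_h,J_v>0$ satisfying $e^{-2J_h}+e^{-2J_v}+e^{-2J_h-2J_v}\neq1$. Then almost surely it has at most one infinite contour.
   Context: For $J_h,J_v>0$, the Ising model on $\mathbb{Z}^2$ (nearest-neighbour edges) with coupling $J_h$ on horizontal and $J_v$ on vertical edges and no external field is taken with the infinite-volume law obtained as the weak limit, as $n\to\infty$, of the Ising measures on $n\times n$ tori (periodic boundary conditions). The XOR Ising model is $\sigma_{XOR}(v)=\sigma_1(v)\sigma_2(v)$, where $\sigma_1,\sigma_2$ are independent copies of this Ising model (same $J_h,J_v$). The contour configuration is the set of edges of the dual lattice $(\mathbb{Z}+\tfrac12)^2$ crossing an edge of $\mathbb{Z}^2$ whose endpoints have different values of $\sigma_{XOR}$; a contour is a connected component of this set, infinite if it has infinitely many edges. *)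

theory Defs
  imports "HOL-Probability.Probability"
begin

type_synonym vertex = "int \<times> int"
type_synonym spin_config = "vertex \<Rightarrow> int"

definition config_space :: "spin_config measure" where
  "config_space = PiM UNIV (\<lambda>_. count_space {-1, 1})"

definition torus_configs :: "nat \<Rightarrow> spin_config set" where
  "torus_configs n = PiE ({0..<int n} \<times> {0..<int n}) (\<lambda>_. {-1, 1})"

definition torus_weight :: "real \<Rightarrow> real \<Rightarrow> nat \<Rightarrow> spin_config \<Rightarrow> real" where
  "torus_weight Jh Jv n \<tau> = exp (\<Sum>v\<in>{0..<int n} \<times> {0..<int n}.
      Jh * of_int (\<tau> v * \<tau> ((fst v + 1) mod int n, snd v))
    + Jv * of_int (\<tau> v * \<tau> (fst v, (snd v + 1) mod int n)))"

definition torus_cyl_prob ::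
  "real \<Rightarrow> real \<Rightarrow> nat \<Rightarrow> vertex set \<Rightarrow> spin_config \<Rightarrow> real" where
  "torus_cyl_prob Jh Jv n \<Lambda> \<eta> =
     (\<Sum>\<tau>\<in>torus_configs n.
        if (\<forall>v\<in>\<Lambda>. \<tau> (fst v mod int n, snd v mod int n) = \<eta> v)
        then torus_weight Jh Jv n \<tau> else 0)
     / (\<Sum>\<tau>\<in>torus_configs n. torus_weight Jh Jv n \<tau>)"

text \<open>mu is the weak limit of the torus Ising measures. Since the configuration space is
  a product of finite spaces, weak convergence is equivalent to convergence of the
  probabilities of all finite-dimensional cylinder events.\<close>
definition ising_infinite_volume_limit :: "real \<Rightarrow> real \<Rightarrow> spin_config measure \<Rightarrow> bool" where
  "ising_infinite_volume_limit Jh Jv \<mu> \<longleftrightarrow>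
     prob_space \<mu> \<and> sets \<mu> = sets config_space \<and>
     (\<forall>\<Lambda> \<eta>. finite \<Lambda> \<longrightarrow>
        (\<lambda>n. torus_cyl_prob Jh Jv n \<Lambda> \<eta>) \<longlonglongrightarrow>
          measure \<mu> {\<sigma> \<in> space config_space. \<forall>v\<in>\<Lambda>. \<sigma> v = \<eta> v})"

text \<open>Edges of Z^2: (v, True) is the horizontal edge {v, v+(1,0)},
  (v, False) the vertical edge {v, v+(0,1)}.\<close>
type_synonym edge = "vertex \<times> bool"

definition edge_ends :: "edge \<Rightarrow> vertex \<times> vertex" where
  "edge_ends e = (let (x, y) = fst e in
     if snd e then ((x, y), (x + 1, y)) else ((x, y), (x, y + 1)))"

text \<open>The dual vertex (a+1/2, b+1/2) is represented by (a, b). Endpoints of the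
  dual edge crossing the primal edge e.\<close>
definition dual_ends :: "edge \<Rightarrow> vertex set" where
  "dual_ends e = (let (x, y) = fst e in
     if snd e then {(x, y - 1), (x, y)} else {(x - 1, y), (x, y)})"

text \<open>Contour configuration: the (primal edges crossed by the) dual edges whose primal
  edge has endpoints of different spin.\<close>
definition contour_edges :: "spin_config \<Rightarrow> edge set" where
  "contour_edges \<sigma> = {e. \<sigma> (fst (edge_ends e)) \<noteq> \<sigma> (snd (edge_ends e))}"

definition contour_adj :: "spin_config \<Rightarrow> (edge \<times> edge) set" where
  "contour_adj \<sigma> = {(e, f). e \<in> contour_edges \<sigma> \<and> f \<in> contour_edges \<sigma> \<and>
                              dual_ends e \<inter> dual_ends f \<noteq> {}}"

definition contour_of :: "spin_config \<Rightarrow> edge \<Rightarrow> edge set" where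
  "contour_of \<sigma> e = (contour_adj \<sigma>)\<^sup>* `` {e}"

definition infinite_contour :: "spin_config \<Rightarrow> edge set \<Rightarrow> bool" where
  "infinite_contour \<sigma> C \<longleftrightarrow> (\<exists>e\<in>contour_edges \<sigma>. C = contour_of \<sigma> e) \<and> infinite C"

definition at_most_one_infinite_contour :: "spin_config \<Rightarrow> bool" where
  "at_most_one_infinite_contour \<sigma> \<longleftrightarrow>
     (\<forall>C D. infinite_contour \<sigma> C \<longrightarrow> infinite_contour \<sigma> D \<longrightarrow> C = D)"

definition xor_config :: "spin_config \<Rightarrow> spin_config \<Rightarrow> spin_config" where
  "xor_config \<sigma>1 \<sigma>2 = (\<lambda>v. \<sigma>1 v * \<sigma>2 v)"

end

theory Submission
  imports Defs
begin

text \<open>This is a Burton-Keane argument. The torus limit is translation invariant, and flipping a spin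
  multiplies the weight of a torus configuration by a bounded factor; both properties pass to the law
  of the XOR configuration. A translation invariant event is approximated by local events, which may be
  moved far away from any given spin, so up to null sets it is unaffected by changing finitely many
  spins. Three infinite contours meeting a large box can be tied together by changing the spins in
  the box only, which produces a trifurcation; by translation invariance and a comparison of the area of
  a large box with its boundary, trifurcations almost surely do not exist. If there are exactly two infinite
  contours, the same local change merges them, contradicting that having at most one
  is not affected by local changes.\<close>

section \<open>Clusters and trifurcations in graphs\<close>

text \<open>Its role is taken by the insensitivity of translation invariant events to finite flips,
  and the last part of the argument runs configuration by configuration, on a set of full measure
  where all finite flips behave well at once. The second obstacle is that contour edges cannot be
  added one at a time: an even number of them meets at each dual vertex, and the spins outside the
  box are given. The new spins must make the contours in the box connected and also catch every
  outer contour that arrives at the box. One checkerboard fails: its four corner spins agree, so for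
  some outer spins a contour passes a corner without meeting it. A separate sign for each quadrant
  cures the corners. The price is a seam between quadrants; rows and columns of dual edges cross it,
  and its ends on the boundary are handled by the parity at a dual vertex.\<close>

definition cluster :: "('a \<times> 'a) set \<Rightarrow> 'a set \<Rightarrow> 'a \<Rightarrow> 'a set" where
  "cluster R A x = (Restr R A)\<^sup>* `` {x}"

definition connected_in :: "('a \<times> 'a) set \<Rightarrow> 'a set \<Rightarrow> bool" where
  "connected_in R C \<longleftrightarrow> (\<forall>x\<in>C. C \<subseteq> cluster R C x)"

lemma cluster_self [simp]: "x \<in> cluster R A x"
  by (simp add: cluster_def)

lemma cluster_step:
  assumes "y \<in> cluster R A x" "(y, z) \<in> R" "y \<in> A" "z \<in> A"
  shows "z \<in> cluster R A x"
  using assms unfolding cluster_def by (auto intro: rtrancl_into_rtrancl)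

lemma cluster_induct [consumes 1, case_names self step]:
  assumes "y \<in> cluster R A x" and "P x"
    and "\<And>y z. y \<in> cluster R A x \<Longrightarrow> P y \<Longrightarrow> (y, z) \<in> R \<Longrightarrow> y \<in> A \<Longrightarrow> z \<in> A \<Longrightarrow> P z"
  shows "P y"
proof -
  have "(x, y) \<in> (Restr R A)\<^sup>*" using assms(1) by (simp add: cluster_def)
  then show ?thesis
    by (induction rule: rtrancl_induct) (use assms(2,3) in \<open>auto simp: cluster_def\<close>)
qed

lemma cluster_subset: "x \<in> A \<Longrightarrow> cluster R A x \<subseteq> A"
  by (auto elim: cluster_induct)

lemma cluster_subsetI:
  assumes "x \<in> C" "\<And>y z. y \<in> C \<Longrightarrow> (y, z) \<in> R \<Longrightarrow> y \<in> A \<Longrightarrow> z \<in> A \<Longrightarrow> z \<in> C"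
  shows "cluster R A x \<subseteq> C"
  using assms by (auto elim: cluster_induct)

lemma cluster_mono: "A \<subseteq> B \<Longrightarrow> cluster R A x \<subseteq> cluster R B x"
  by (rule cluster_subsetI) (auto intro: cluster_step)

lemma cluster_eq:
  assumes "sym R" "y \<in> cluster R A x"
  shows "cluster R A y = cluster R A x"
proof -
  have s: "sym ((Restr R A)\<^sup>*)"
    using assms(1) by (intro sym_rtrancl) (auto simp: sym_def)
  have xy: "(x, y) \<in> (Restr R A)\<^sup>*" using assms(2) by (simp add: cluster_def)
  then have yx: "(y, x) \<in> (Restr R A)\<^sup>*" using s by (blast dest: symD)
  show ?thesis unfolding cluster_def using xy yx by (auto intro: rtrancl_trans)
qed

lemma cluster_disjoint:
  assumes "sym R" "cluster R A x \<noteq> cluster R A y"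
  shows "cluster R A x \<inter> cluster R A y = {}"
proof (rule ccontr)
  assume "\<not> ?thesis"
  then obtain z where "z \<in> cluster R A x" "z \<in> cluster R A y" by blast
  then show False using assms(2) cluster_eq[OF assms(1)] by metis
qed

lemma cluster_connected: "sym R \<Longrightarrow> connected_in R (cluster R A x)"
proof -
  assume R: "sym R"
  have "y \<in> cluster R (cluster R A x) x" if "y \<in> cluster R A x" for y
    using that
  proof (induction rule: cluster_induct)
    case (step y z)
    then show ?case by (meson cluster_step)
  qed simp
  then have "cluster R A x \<subseteq> cluster R (cluster R A x) y" if "y \<in> cluster R A x" for y
    using that cluster_eq[OF R, of y "cluster R A x" x] by blast
  then show ?thesis by (simp add: connected_in_def)
qed

lemma connected_subset_cluster:
  assumes "connected_in R C" "C \<subseteq> A" "x \<in> C"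
  shows "C \<subseteq> cluster R A x"
proof -
  have "C \<subseteq> cluster R C x" using assms(1,3) by (simp add: connected_in_def)
  also have "\<dots> \<subseteq> cluster R A x" using assms(2) by (rule cluster_mono)
  finally show ?thesis .
qed

lemma cluster_restrict:
  assumes "cluster R A x \<subseteq> B" "B \<subseteq> A" "sym R"
  shows "cluster R B x = cluster R A x"
proof
  show "cluster R B x \<subseteq> cluster R A x" using assms(2) by (rule cluster_mono)
  show "cluster R A x \<subseteq> cluster R B x"
    using cluster_connected[OF assms(3)] assms(1) by (rule connected_subset_cluster) simp
qed

text \<open>Follow a path from \<open>x\<close> to \<open>y\<close> up to its first entry into
  \<open>W\<close>: \<open>z\<close> is the last vertex before the entry and \<open>w\<close> the
  entry itself.\<close>

lemma cluster_exit:
  assumes "y \<in> cluster R A x" "y \<in> W" "x \<in> A - W"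
  obtains z w where "z \<in> cluster R (A - W) x" "w \<in> A \<inter> W" "(z, w) \<in> R"
proof -
  have "y \<in> cluster R (A - W) x \<or> (\<exists>z\<in>cluster R (A - W) x. \<exists>w\<in>A \<inter> W. (z, w) \<in> R)"
    using assms(1)
  proof (induction rule: cluster_induct)
    case (step y z)
    then show ?case
      using cluster_subset[OF assms(3), of R] by (cases "z \<in> W") (auto intro: cluster_step)
  qed simp
  then show ?thesis
    using cluster_subset[OF assms(3), of R] assms(2) that by blast
qed

text \<open>The points \<open>d1\<close>, \<open>d2\<close>, \<open>d3\<close> represent three
  different infinite components that border \<open>W\<close>. The cut set is a connected set and not
  a single vertex because the local change of spins controls only a whole box.\<close>

definition trifurcation :: "('a \<times> 'a) set \<Rightarrow> 'a set \<Rightarrow> 'a set \<Rightarrow> bool" where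
  "trifurcation R V W \<longleftrightarrow> connected_in R W \<and>
     (\<exists>d1 d2 d3. (\<forall>d\<in>{d1, d2, d3}. d \<in> V - W \<and> (\<exists>w\<in>W. (w, d) \<in> R)
          \<and> infinite (cluster R (V - W) d))
        \<and> d2 \<notin> cluster R (V - W) d1 \<and> d3 \<notin> cluster R (V - W) d1
        \<and> d3 \<notin> cluster R (V - W) d2)"

lemma trifurcation_two_others:
  assumes "trifurcation R V W" "sym R"
  obtains d e where "\<And>c. c \<in> {d, e} \<Longrightarrow> c \<in> V - W \<and> (\<exists>w\<in>W. (w, c) \<in> R)
          \<and> infinite (cluster R (V - W) c) \<and> cluster R (V - W) c \<noteq> B"
    "cluster R (V - W) d \<noteq> cluster R (V - W) e"
proof -
  obtain d1 d2 d3 where d: "\<forall>d\<in>{d1, d2, d3}. d \<in> V - W \<and> (\<exists>w\<in>W. (w, d) \<in> R)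
          \<and> infinite (cluster R (V - W) d)"
        "d2 \<notin> cluster R (V - W) d1" "d3 \<notin> cluster R (V - W) d1"
        "d3 \<notin> cluster R (V - W) d2"
    using assms(1) unfolding trifurcation_def by blast
  have ne: "cluster R (V - W) d1 \<noteq> cluster R (V - W) d2"
    "cluster R (V - W) d1 \<noteq> cluster R (V - W) d3"
    "cluster R (V - W) d2 \<noteq> cluster R (V - W) d3"
    using d(2-4) cluster_self by metis+
  consider "cluster R (V - W) d1 = B" | "cluster R (V - W) d2 = B"
    | "cluster R (V - W) d1 \<noteq> B" "cluster R (V - W) d2 \<noteq> B" by blast
  then show ?thesis
  proof cases
    case 1
    then show ?thesis using that[of d2 d3] d ne by blast
  next
    case 2
    then show ?thesis using that[of d1 d3] d ne by blast
  next
    case 3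
    then show ?thesis using that[of d1 d2] d ne by blast
  qed
qed

definition branches :: "('a \<times> 'a) set \<Rightarrow> 'a set \<Rightarrow> 'a set \<Rightarrow> 'a set set" where
  "branches R V U = {cluster R (V - U) x |x. x \<in> V - U \<and> (\<exists>w\<in>U. (w, x) \<in> R)
      \<and> infinite (cluster R (V - U) x)}"

text \<open>Take a cut set with a branch containing as many of the other cut sets as possible.\<close>
lemma exists_leaf:
  assumes R: "sym R" and T: "finite T" "T \<noteq> {}"
    and W: "\<And>t. t \<in> T \<Longrightarrow> W t \<subseteq> V \<and> connected_in R (W t)"
    and disj: "\<And>s t. s \<in> T \<Longrightarrow> t \<in> T \<Longrightarrow> s \<noteq> t \<Longrightarrow> W s \<inter> W t = {}"
    and ne: "\<And>t. t \<in> T \<Longrightarrow> \<exists>x\<in>V - W t. \<exists>w\<in>W t. (w, x) \<in> R"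
  obtains t B where "t \<in> T" "\<And>x s. x \<in> V - W t \<Longrightarrow> \<exists>w\<in>W t. (w, x) \<in> R \<Longrightarrow>
      cluster R (V - W t) x \<noteq> B \<Longrightarrow> s \<in> T \<Longrightarrow> cluster R (V - W t) x \<inter> W s = {}"
proof -
  define P where "P = (\<lambda>(t, x). t \<in> T \<and> x \<in> V - W t \<and> (\<exists>w\<in>W t. (w, x) \<in> R))"
  \<comment> \<open>Cut sets are connected and disjoint, so a branch at \<open>t\<close> contains
    any other cut set that it meets. The count is bounded by \<open>card T\<close>, hence a maximal
    pair exists.\<close>
  define f where "f = (\<lambda>(t, x). card {s\<in>T. W s \<subseteq> cluster R (V - W t) x})"
  obtain t0 where "t0 \<in> T" using T by blast
  then obtain x0 where "P (t0, x0)" using ne[of t0] by (auto simp: P_def)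
  moreover have "\<forall>p. P p \<longrightarrow> f p < Suc (card T)"
    by (auto simp: f_def less_Suc_eq_le intro!: card_mono T)
  ultimately obtain p where p: "P p" "\<And>q. P q \<Longrightarrow> f q \<le> f p"
    using ex_has_greatest_nat[of P "(t0, x0)" f] by blast
  obtain t y where [simp]: "p = (t, y)" by (cases p)
  have t: "t \<in> T" "y \<in> V - W t" "\<exists>w\<in>W t. (w, y) \<in> R" using p(1) by (auto simp: P_def)
  define B where "B = cluster R (V - W t) y"
  have "cluster R (V - W t) x \<inter> W s = {}"
    if x: "x \<in> V - W t" "\<exists>w\<in>W t. (w, x) \<in> R" "cluster R (V - W t) x \<noteq> B" "s \<in> T" for x s
  proof (rule ccontr)
    assume meet: "cluster R (V - W t) x \<inter> W s \<noteq> {}"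
    then have "s \<noteq> t" using cluster_subset[OF x(1), of R] by auto
    have Ws: "W s \<subseteq> V - W t" using disj[OF \<open>s \<in> T\<close> t(1) \<open>s \<noteq> t\<close>] W[OF \<open>s \<in> T\<close>] by blast
    obtain z where z: "z \<in> W s" "z \<in> cluster R (V - W t) x" using meet by blast
    have sub: "W s \<subseteq> cluster R (V - W t) x"
      using connected_subset_cluster[OF conjunct2[OF W[OF \<open>s \<in> T\<close>]] Ws z(1)] cluster_eq[OF R z(2)]
      by simp
    have Bs: "B \<subseteq> V - W s"
      using sub cluster_disjoint[OF R x(3)[unfolded B_def]] cluster_subset[OF t(2), of R]
      unfolding B_def by blast
    have Wt: "W t \<subseteq> V - W s" using disj[OF \<open>s \<in> T\<close> t(1) \<open>s \<noteq> t\<close>] W[OF t(1)] by blast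
    obtain w where w: "w \<in> W t" "(w, x) \<in> R" using x(2) by blast
    obtain w' where w': "w' \<in> W t" "(w', y) \<in> R" using t(3) by blast
    \<comment> \<open>Seen from \<open>s\<close>, the branch through \<open>W t\<close> swallows all
      of \<open>B\<close> and also \<open>W t\<close>, which \<open>B\<close> misses. It therefore
      contains more cut sets than the maximal branch.\<close>
    define G where "G = cluster R (V - W s) w"
    have WtG: "W t \<subseteq> G" unfolding G_def
      using connected_subset_cluster[OF conjunct2[OF W[OF t(1)]] Wt w(1)] .
    have yB: "y \<in> B" by (simp add: B_def)
    have yG: "y \<in> G"
      using WtG w' Wt Bs yB unfolding G_def by (meson cluster_step subsetD)
    have BG: "B \<subseteq> G"
      using connected_subset_cluster[OF cluster_connected[OF R] Bs[unfolded B_def], of y]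
        cluster_eq[OF R yG[unfolded G_def]] unfolding B_def G_def by simp
    \<comment> \<open>To contradict maximality, \<open>G\<close> must be a branch at
      \<open>s\<close>, that is, border \<open>W s\<close>. The path from \<open>W t\<close> through
      \<open>x\<close> to \<open>z\<close> supplies the vertex \<open>g\<close> of \<open>G\<close>
      next to \<open>W s\<close>.\<close>
    have "x \<in> cluster R V w"
      by (rule cluster_step[OF cluster_self]) (use w x W[OF t(1)] in auto)
    then have "z \<in> cluster R V w"
      using z(2) cluster_mono[of "V - W t" V R x] cluster_eq[OF R, of x V w] by blast
    then obtain g h where gh: "g \<in> cluster R (V - W s) w" "h \<in> V \<inter> W s" "(g, h) \<in> R"
      by (rule cluster_exit[OF _ z(1)]) (use w Wt in auto)
    have "g \<in> V - W s" using gh(1) cluster_subset[of w "V - W s" R] w Wt by blast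
    then have "P (s, g)" using gh \<open>s \<in> T\<close> R unfolding P_def by (auto dest: symD)
    then have "f (s, g) \<le> f (t, y)" using p(2) by simp
    moreover have "{r\<in>T. W r \<subseteq> B} \<subset> {r\<in>T. W r \<subseteq> G}"
    proof -
      have "\<not> W t \<subseteq> B" using w(1) cluster_subset[OF t(2), of R] unfolding B_def by blast
      then show ?thesis using BG WtG t(1) by blast
    qed
    then have "card {r\<in>T. W r \<subseteq> B} < card {r\<in>T. W r \<subseteq> G}"
      using T(1) by (intro psubset_card_mono) auto
    then have "f (t, y) < f (s, g)"
      using cluster_eq[OF R gh(1)] by (simp add: f_def B_def G_def)
    ultimately show False by simp
  qed
  then show ?thesis using that t(1) by blast
qed

text \<open>Induction that removes a leaf \<open>t\<close> from the family. Deleting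
  \<open>W t\<close> in addition to the other cut sets destroys at most one branch, the one
  containing \<open>W t\<close>, and creates at least two: the branches of \<open>t\<close> other
  than \<open>B\<close> meet no cut set and survive intact. Finiteness is required for all
  subfamilies because the induction passes to them and \<open>card\<close> of an infinite set is
  0.\<close>

lemma card_branches_ge:
  assumes R: "sym R" and T: "finite T"
    and W: "\<And>t. t \<in> T \<Longrightarrow> W t \<subseteq> V \<and> trifurcation R V (W t)"
    and disj: "\<And>s t. s \<in> T \<Longrightarrow> t \<in> T \<Longrightarrow> s \<noteq> t \<Longrightarrow> W s \<inter> W t = {}"
    and fin: "\<And>S. S \<subseteq> T \<Longrightarrow> finite (branches R V (\<Union>(W ` S)))"
  shows "card T \<le> card (branches R V (\<Union>(W ` T)))"
  using T W disj fin
proof (induction T rule: finite_psubset_induct)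
  case (psubset T)
  show ?case
  proof (cases "T = {}")
    case False
    have W1: "W t \<subseteq> V" "connected_in R (W t)" "\<exists>x\<in>V - W t. \<exists>w\<in>W t. (w, x) \<in> R"
      if "t \<in> T" for t
      using psubset.prems(1)[OF that] unfolding trifurcation_def by blast+
    obtain t B where t: "t \<in> T" and leaf: "\<And>x s. x \<in> V - W t \<Longrightarrow> \<exists>w\<in>W t. (w, x) \<in> R \<Longrightarrow>
        cluster R (V - W t) x \<noteq> B \<Longrightarrow> s \<in> T \<Longrightarrow> cluster R (V - W t) x \<inter> W s = {}"
    proof (rule exists_leaf[OF R psubset.hyps(1) False, of W V])
      show "W s \<subseteq> V \<and> connected_in R (W s)" if "s \<in> T" for s using W1[OF that] by blast
      show "\<exists>x\<in>V - W s. \<exists>w\<in>W s. (w, x) \<in> R" if "s \<in> T" for s using W1[OF that] by blast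
    qed (use psubset.prems(2) in blast)+
    obtain d e where de: "\<And>c. c \<in> {d, e} \<Longrightarrow> c \<in> V - W t \<and> (\<exists>w\<in>W t. (w, c) \<in> R)
          \<and> infinite (cluster R (V - W t) c) \<and> cluster R (V - W t) c \<noteq> B"
      "cluster R (V - W t) d \<noteq> cluster R (V - W t) e"
      using trifurcation_two_others[OF conjunct2[OF psubset.prems(1)[OF t]] R, of B] by blast
    define U where "U = \<Union>(W ` T)"
    define U' where "U' = \<Union>(W ` (T - {t}))"
    have UU: "U = U' \<union> W t" using t by (auto simp: U_def U'_def)
    have disjU: "W t \<inter> U' = {}"
      unfolding U'_def using psubset.prems(2)[OF t] by blast
    have "card (T - {t}) \<le> card (branches R V U')"
      unfolding U'_def
    proof (rule psubset.IH)
      show "T - {t} \<subset> T" using t by blast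
      show "W s \<subseteq> V \<and> trifurcation R V (W s)" if "s \<in> T - {t}" for s
        using psubset.prems(1) that by blast
      show "W s \<inter> W r = {}" if "s \<in> T - {t}" "r \<in> T - {t}" "s \<noteq> r" for s r
        using psubset.prems(2) that by blast
      show "finite (branches R V (\<Union> (W ` S)))" if "S \<subseteq> T - {t}" for S
        using psubset.prems(3) that by blast
    qed
    moreover have "card (branches R V U') < card (branches R V U)"
    proof -
      \<comment> \<open>The branches at \<open>d\<close> and \<open>e\<close> are genuinely new:
        before the deletion of \<open>W t\<close> they were parts of a component that meets
        \<open>W t\<close>.\<close>
      have br: "cluster R (V - U) c = cluster R (V - W t) c"
        "cluster R (V - U) c \<in> branches R V U" "cluster R (V - U') c \<inter> W t \<noteq> {}"
        if "c \<in> {d, e}" for c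
      proof -
        have c: "c \<in> V - W t" "\<exists>w\<in>W t. (w, c) \<in> R" "infinite (cluster R (V - W t) c)"
          "cluster R (V - W t) c \<noteq> B" using de(1)[OF that] by auto
        have "cluster R (V - W t) c \<subseteq> V - U"
          unfolding U_def using leaf[OF c(1,2,4)] cluster_subset[OF c(1), of R] by blast
        then show eq: "cluster R (V - U) c = cluster R (V - W t) c"
          by (rule cluster_restrict) (use R UU in auto)
        have cU: "c \<in> V - U" using \<open>cluster R (V - W t) c \<subseteq> V - U\<close> cluster_self[of c R "V - W t"] by (rule subsetD)
        then show "cluster R (V - U) c \<in> branches R V U"
          unfolding branches_def using c eq t UU by auto
        obtain w where w: "w \<in> W t" "(w, c) \<in> R" using c(2) by blast
        have "w \<in> cluster R (V - U') c"
          by (rule cluster_step[OF cluster_self])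
             (use w R cU UU disjU W1(1)[OF t] in \<open>auto dest: symD\<close>)
        then show "cluster R (V - U') c \<inter> W t \<noteq> {}" using w by blast
      qed
      define K where "K = cluster R (V - U) d"
      define L where "L = cluster R (V - U) e"
      have KL: "K \<in> branches R V U" "L \<in> branches R V U" "K \<noteq> L"
        using br de(2) by (auto simp: K_def L_def)
      obtain w0 where w0: "w0 \<in> W t" using de(1)[of d] by blast
      have Wsub: "W t \<subseteq> cluster R (V - U') w0"
        using connected_subset_cluster[OF W1(2)[OF t] _ w0, of "V - U'"] W1(1)[OF t] disjU by blast
      \<comment> \<open>An old branch that misses \<open>W t\<close> is still a branch, but neither
        \<open>K\<close> nor \<open>L\<close>; one that meets \<open>W t\<close> contains it and is
        the component of \<open>w0\<close>.\<close>
      have "branches R V U' \<subseteq> insert (cluster R (V - U') w0) (branches R V U - {K, L})"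
      proof
        fix C assume "C \<in> branches R V U'"
        then obtain x where x: "C = cluster R (V - U') x" "x \<in> V - U'" "\<exists>w\<in>U'. (w, x) \<in> R"
          "infinite C" unfolding branches_def by auto
        show "C \<in> insert (cluster R (V - U') w0) (branches R V U - {K, L})"
        proof (cases "C \<inter> W t = {}")
          case True
          have CU: "C \<subseteq> V - U" using True cluster_subset[OF x(2), of R] x(1) UU by blast
          then have eq: "cluster R (V - U) x = C"
            unfolding x(1) by (rule cluster_restrict) (use R UU in auto)
          have "x \<in> C" by (simp add: x(1))
          then have "C \<in> branches R V U"
            unfolding branches_def using eq x CU UU by blast
          moreover have "C \<noteq> cluster R (V - U) c" if "c \<in> {d, e}" for c
          proof
            assume "C = cluster R (V - U) c"
            then have "c \<in> cluster R (V - U') x" unfolding x(1)[symmetric] by simp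
            then have "C = cluster R (V - U') c" using cluster_eq[OF R] x(1) by blast
            then show False using br(3)[OF that] True by simp
          qed
          ultimately show ?thesis by (auto simp: K_def L_def)
        next
          case False
          then obtain z where "z \<in> C" "z \<in> cluster R (V - U') w0" using Wsub by blast
          then show ?thesis using cluster_eq[OF R] x(1) by blast
        qed
      qed
      moreover have fU: "finite (branches R V U)" unfolding U_def using psubset.prems(3)[of T] by simp
      ultimately have "card (branches R V U') \<le> card (insert (cluster R (V - U') w0) (branches R V U - {K, L}))"
        by (intro card_mono) auto
      also have "\<dots> \<le> Suc (card (branches R V U - {K, L}))"
        using fU by (simp add: card_insert_if)
      also have "card (branches R V U - {K, L}) = card (branches R V U) - 2"
        using KL fU by (simp add: card_Diff_subset)
      \<comment> \<open>Subtraction on naturals truncates, so the presence of the two distinct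
        branches \<open>K\<close> and \<open>L\<close> is needed here.\<close>
      also have "Suc (card (branches R V U) - 2) < card (branches R V U)"
      proof -
        have "card {K, L} \<le> card (branches R V U)" using KL fU by (intro card_mono) auto
        then show ?thesis using KL(3) by simp
      qed
      finally show ?thesis .
    qed
    ultimately show ?thesis
      using t psubset.hyps(1) unfolding U_def by (simp add: card_Diff_singleton_if)
  qed simp
qed

text \<open>Branches are disjoint and each contains a point of \<open>Y\<close>, so choosing such
  points is injective. This also gives the finiteness needed by the branch count. The hypothesis
  \<open>meet\<close> speaks of arbitrary \<open>A\<close> because the deleted set varies with the
  subfamily. In the application \<open>Y\<close> is the boundary of a large box.\<close>

lemma card_trifurcations_le:
  assumes R: "sym R" and T: "finite T" and Y: "finite Y"
    and W: "\<And>t. t \<in> T \<Longrightarrow> W t \<subseteq> V \<and> trifurcation R V (W t)"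
    and disj: "\<And>s t. s \<in> T \<Longrightarrow> t \<in> T \<Longrightarrow> s \<noteq> t \<Longrightarrow> W s \<inter> W t = {}"
    and meet: "\<And>A t w x. A \<subseteq> V \<Longrightarrow> t \<in> T \<Longrightarrow> w \<in> W t \<Longrightarrow> (w, x) \<in> R \<Longrightarrow> x \<in> A \<Longrightarrow>
        infinite (cluster R A x) \<Longrightarrow> cluster R A x \<inter> Y \<noteq> {}"
  shows "card T \<le> card Y"
proof -
  have br: "finite (branches R V (\<Union>(W ` S))) \<and> card (branches R V (\<Union>(W ` S))) \<le> card Y"
    if "S \<subseteq> T" for S
  proof -
    let ?B = "branches R V (\<Union>(W ` S))"
    define f where "f = (\<lambda>K. SOME y. y \<in> K \<inter> Y)"
    have f: "f K \<in> K \<inter> Y" if K: "K \<in> ?B" for K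
    proof -
      obtain x w where x: "K = cluster R (V - \<Union>(W ` S)) x" "x \<in> V - \<Union>(W ` S)"
        "w \<in> \<Union>(W ` S)" "(w, x) \<in> R" "infinite K"
        using K unfolding branches_def by blast
      then obtain t where t: "t \<in> S" "w \<in> W t" by blast
      have "K \<inter> Y \<noteq> {}"
        unfolding x(1) by (rule meet[of _ t w]) (use x t \<open>S \<subseteq> T\<close> in auto)
      then show ?thesis unfolding f_def by (meson ex_in_conv someI_ex)
    qed
    have "inj_on f ?B"
    proof
      fix K L assume KL: "K \<in> ?B" "L \<in> ?B" "f K = f L"
      then have "K \<inter> L \<noteq> {}" using f by (metis IntD1 disjoint_iff)
      then show "K = L" using KL(1,2) cluster_disjoint[OF R] unfolding branches_def by blast
    qed
    moreover have "f ` ?B \<subseteq> Y" using f by blast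
    ultimately show ?thesis using Y by (meson card_inj_on_le inj_on_finite)
  qed
  have "card T \<le> card (branches R V (\<Union>(W ` T)))"
    using R T W disj
  proof (rule card_branches_ge)
    show "finite (branches R V (\<Union>(W ` S)))" if "S \<subseteq> T" for S
      using br[OF that] by blast
  qed
  also have "\<dots> \<le> card Y" using br[of T] by blast
  finally show ?thesis .
qed

section \<open>Spin measures with bounded flip ratios\<close>

definition translate :: "vertex \<Rightarrow> spin_config \<Rightarrow> spin_config" where
  "translate z \<sigma> = (\<lambda>v. \<sigma> (v + z))"

definition flip :: "vertex set \<Rightarrow> spin_config \<Rightarrow> spin_config" where
  "flip S \<sigma> = (\<lambda>v. if v \<in> S then - \<sigma> v else \<sigma> v)"

definition cylinder :: "vertex set \<Rightarrow> spin_config \<Rightarrow> spin_config set" where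
  "cylinder \<Lambda> \<eta> = {\<sigma> \<in> space config_space. \<forall>v\<in>\<Lambda>. \<sigma> v = \<eta> v}"

definition local_event :: "vertex set \<Rightarrow> spin_config set \<Rightarrow> bool" where
  "local_event \<Lambda> B \<longleftrightarrow> B \<in> sets config_space \<and>
     (\<forall>\<sigma>\<in>space config_space. \<forall>\<tau>\<in>space config_space.
        (\<forall>v\<in>\<Lambda>. \<sigma> v = \<tau> v) \<longrightarrow> (\<sigma> \<in> B \<longleftrightarrow> \<tau> \<in> B))"

lemma space_config: "space config_space = UNIV \<rightarrow> {-1, 1}"
  by (simp add: config_space_def space_PiM PiE_UNIV_domain)

lemma measurable_spin [measurable]: "(\<lambda>\<sigma>. \<sigma> v) \<in> measurable config_space (count_space {-1, 1})"
  unfolding config_space_def by measurable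

lemma flip_in_space: "\<sigma> \<in> space config_space \<Longrightarrow> flip S \<sigma> \<in> space config_space"
  unfolding space_config Pi_iff
proof
  fix v
  assume "\<forall>v\<in>UNIV. \<sigma> v \<in> {-1, 1}"
  then have "\<sigma> v \<in> {-1, 1}" by blast
  then show "flip S \<sigma> v \<in> {-1, 1}" by (auto simp: flip_def)
qed

lemma translate_in_space: "\<sigma> \<in> space config_space \<Longrightarrow> translate z \<sigma> \<in> space config_space"
  unfolding space_config translate_def Pi_iff by blast

lemma translate_apply: "translate z \<sigma> v = \<sigma> (v + z)"
  by (simp add: translate_def)

lemma measurable_translate [measurable]: "translate z \<in> measurable config_space config_space"
  unfolding translate_def by (subst (2) config_space_def, rule measurable_PiM_single')
    (auto simp: space_config)

lemma measurable_flip [measurable]: "flip S \<in> measurable config_space config_space"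
proof -
  have "(\<lambda>\<sigma>. flip S \<sigma> v) \<in> measurable config_space (count_space {-1, 1})" for v
  proof -
    have "uminus \<in> measurable (count_space {-1, 1 :: int}) (count_space {-1, 1})" by simp
    then have "(\<lambda>\<sigma>. - \<sigma> v) \<in> measurable config_space (count_space {-1, 1 :: int})"
      by (rule measurable_compose[OF measurable_spin])
    then show ?thesis by (simp add: flip_def)
  qed
  moreover have "flip S \<in> space config_space \<rightarrow> (\<Pi>\<^sub>E v\<in>UNIV. space (count_space {-1, 1}))"
    using flip_in_space by (auto simp: space_config PiE_UNIV_domain)
  ultimately show ?thesis
    by (subst (2) config_space_def) (rule measurable_PiM_single', auto)
qed

lemma sets_cylinder [measurable]: "finite \<Lambda> \<Longrightarrow> cylinder \<Lambda> \<eta> \<in> sets config_space"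
proof -
  assume "finite \<Lambda>"
  have "{\<sigma> \<in> space config_space. \<sigma> v = \<eta> v} \<in> sets config_space" for v
    using measurable_sets[OF measurable_spin[of v], of "{\<eta> v} \<inter> {-1, 1}"]
    by (rule back_subst[where P = "\<lambda>A. A \<in> _"]) (auto simp: space_config)
  then show ?thesis
    unfolding cylinder_def using \<open>finite \<Lambda>\<close> by (intro sets.sets_Collect_finite_All)
qed

lemma sets_config: "sets config_space = sigma_sets (UNIV \<rightarrow> {-1, 1})
    {{\<sigma> \<in> UNIV \<rightarrow> {-1, 1}. \<sigma> v \<in> A} |v A. A \<subseteq> {-1, 1}}"
  unfolding config_space_def sets_PiM_single by (simp add: PiE_UNIV_domain)

section \<open>Approximation of events by events that depend on finitely many spins\<close>

lemma local_event_UN: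
  assumes "finite I" "\<And>i. local_event (L i) (b i)"
  shows "local_event (\<Union>i\<in>I. L i) (\<Union>i\<in>I. b i)"
  unfolding local_event_def
proof (intro conjI ballI impI)
  show "(\<Union>i\<in>I. b i) \<in> sets config_space"
    using assms unfolding local_event_def by (intro sets.finite_UN) auto
  fix \<sigma> \<tau> assume "\<sigma> \<in> space config_space" "\<tau> \<in> space config_space"
    and eq: "\<forall>v\<in>\<Union>i\<in>I. L i. \<sigma> v = \<tau> v"
  then have "\<sigma> \<in> b i \<longleftrightarrow> \<tau> \<in> b i" if "i \<in> I" for i
    using assms(2)[of i] that unfolding local_event_def by blast
  then show "\<sigma> \<in> (\<Union>i\<in>I. b i) \<longleftrightarrow> \<tau> \<in> (\<Union>i\<in>I. b i)" by blast
qed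

lemma measure_sym_diff_UN:
  fixes a b :: "nat \<Rightarrow> 'a set"
  assumes "finite_measure M" "range a \<subseteq> sets M" "\<And>i. b i \<in> sets M"
  shows "measure M (sym_diff (\<Union>i. a i) (\<Union>i<n. b i)) \<le>
    measure M ((\<Union>i. a i) - (\<Union>i<n. a i)) + (\<Sum>i<n. measure M (sym_diff (a i) (b i)))"
proof -
  interpret finite_measure M by fact
  have [measurable]: "a i \<in> sets M" "b i \<in> sets M" for i using assms by auto
  have "measure M (sym_diff (\<Union>i. a i) (\<Union>i<n. b i)) \<le>
     measure M (((\<Union>i. a i) - (\<Union>i<n. a i)) \<union> (\<Union>i<n. sym_diff (a i) (b i)))"
  proof (rule finite_measure_mono)
    show "((\<Union>i. a i) - (\<Union>i<n. a i)) \<union> (\<Union>i<n. sym_diff (a i) (b i)) \<in> sets M"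
      by (intro sets.Un sets.Diff sets.countable_UN') auto
  qed blast
  also have "\<dots> \<le> measure M ((\<Union>i. a i) - (\<Union>i<n. a i)) + measure M (\<Union>i<n. sym_diff (a i) (b i))"
    by (rule measure_Un_le) auto
  also have "measure M (\<Union>i<n. sym_diff (a i) (b i)) \<le> (\<Sum>i<n. measure M (sym_diff (a i) (b i)))"
    by (rule finite_measure_subadditive_finite) auto
  finally show ?thesis by simp
qed

lemma measure_tail_UN:
  fixes a :: "nat \<Rightarrow> 'a set"
  assumes "finite_measure M" "range a \<subseteq> sets M"
  shows "(\<lambda>n. measure M ((\<Union>i. a i) - (\<Union>i<n. a i))) \<longlonglongrightarrow> 0"
proof -
  interpret finite_measure M by fact
  have [measurable]: "a i \<in> sets M" for i using assms by auto
  have "(\<lambda>n. measure M ((\<Union>i. a i) - (\<Union>i<n. a i))) \<longlonglongrightarrow> measure M (\<Inter>n. (\<Union>i. a i) - (\<Union>i<n. a i))"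
    by (rule finite_Lim_measure_decseq) (auto simp: decseq_def)
  also have "(\<Inter>n. (\<Union>i. a i) - (\<Union>i<n. a i)) = {}" by (auto simp: set_eq_iff)
  finally show ?thesis by simp
qed

text \<open>The approximable events contain the one-spin events and are closed under complements and
  countable unions. Two measures are treated at once so that the same local event serves in a
  comparison of both.\<close>

lemma approximate_by_local:
  assumes M: "finite_measure M" "sets M = sets config_space"
    and N: "finite_measure N" "sets N = sets config_space"
    and A: "A \<in> sets config_space" and "\<epsilon> > 0"
  obtains \<Lambda> B where "finite \<Lambda>" "local_event \<Lambda> B"
    "measure M (sym_diff A B) < \<epsilon>" "measure N (sym_diff A B) < \<epsilon>"
proof -
  have "\<exists>\<Lambda> B. finite \<Lambda> \<and> local_event \<Lambda> B \<and> measure M (sym_diff A B) < \<epsilon> \<and> measure N (sym_diff A B) < \<epsilon>"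
    using A \<open>\<epsilon> > 0\<close> unfolding sets_config
  proof (induction A arbitrary: \<epsilon> rule: sigma_sets.induct)
    case (Basic A)
    then obtain v E where A: "A = {\<sigma> \<in> UNIV \<rightarrow> {-1, 1}. \<sigma> v \<in> E}" "E \<subseteq> {-1, 1}" by blast
    have "A \<in> sets config_space" unfolding sets_config using Basic by (intro sigma_sets.Basic)
    then have "local_event {v} A" by (auto simp: A local_event_def space_config)
    then show ?case using \<open>\<epsilon> > 0\<close> by (intro exI[of _ "{v}"] exI[of _ A]) simp
  next
    case Empty
    then show ?case by (intro exI[of _ "{}"]) (simp add: local_event_def)
  next
    case (Compl A)
    then obtain \<Lambda> B where B: "finite \<Lambda>" "local_event \<Lambda> B" "measure M (sym_diff A B) < \<epsilon>"
      "measure N (sym_diff A B) < \<epsilon>" by blast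
    have "A \<in> sets config_space" unfolding sets_config by (rule Compl.hyps)
    then have "A \<subseteq> space config_space" "B \<subseteq> space config_space"
      using B(2) sets.sets_into_space unfolding local_event_def by blast+
    then have "sym_diff (space config_space - A) (space config_space - B) = sym_diff A B" by blast
    moreover have "local_event \<Lambda> (space config_space - B)"
      using B(2) unfolding local_event_def by blast
    ultimately have "local_event \<Lambda> (space config_space - B) \<and>
        measure M (sym_diff (space config_space - A) (space config_space - B)) < \<epsilon> \<and>
        measure N (sym_diff (space config_space - A) (space config_space - B)) < \<epsilon>"
      using B(3,4) by simp
    then show ?case
      using B(1) unfolding space_config by (intro exI[of _ \<Lambda>] exI[of _ "(UNIV \<rightarrow> {-1, 1}) - B"] conjI) auto
  next
    case (Union a)
    have a: "range a \<subseteq> sets M" "range a \<subseteq> sets N" using Union.hyps M N unfolding sets_config by auto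
    have "eventually (\<lambda>n. measure M ((\<Union>i. a i) - (\<Union>i<n. a i)) < \<epsilon> / 2 \<and>
        measure N ((\<Union>i. a i) - (\<Union>i<n. a i)) < \<epsilon> / 2) sequentially"
      using measure_tail_UN[OF M(1) a(1)] measure_tail_UN[OF N(1) a(2)] \<open>\<epsilon> > 0\<close>
      by (intro eventually_conj) (auto intro!: order_tendstoD(2))
    then obtain n where n: "measure M ((\<Union>i. a i) - (\<Union>i<n. a i)) < \<epsilon> / 2"
      "measure N ((\<Union>i. a i) - (\<Union>i<n. a i)) < \<epsilon> / 2"
      by (auto simp: eventually_sequentially)
    \<comment> \<open>Half of the error is spent on the tail of the union and half on its first
      \<open>n\<close> members; \<open>n + 1\<close> keeps the denominator positive for
      \<open>n = 0\<close>.\<close>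
    define \<delta> where "\<delta> = \<epsilon> / (2 * (real n + 1))"
    have "\<delta> > 0" using \<open>\<epsilon> > 0\<close> by (simp add: \<delta>_def)
    have n\<delta>: "real n * \<delta> \<le> \<epsilon> / 2" using \<open>\<epsilon> > 0\<close> by (simp add: \<delta>_def field_simps)
    obtain L b where b: "\<And>i. finite (L i)" "\<And>i. local_event (L i) (b i)"
      "\<And>i. measure M (sym_diff (a i) (b i)) < \<delta>" "\<And>i. measure N (sym_diff (a i) (b i)) < \<delta>"
      using Union.IH[OF \<open>\<delta> > 0\<close>] by (metis (no_types))
    have bs: "b i \<in> sets config_space" for i using b(2) by (simp add: local_event_def)
    have "local_event (\<Union>i<n. L i) (\<Union>i<n. b i)"
      by (rule local_event_UN) (simp_all add: b(2))
    moreover have "measure M (sym_diff (\<Union>i. a i) (\<Union>i<n. b i)) < \<epsilon>"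
    proof -
      have "(\<Sum>i<n. measure M (sym_diff (a i) (b i))) \<le> real n * \<delta>"
        using sum_bounded_above[of "{..<n}" "\<lambda>i. measure M (sym_diff (a i) (b i))" \<delta>]
          less_imp_le[OF b(3)] by simp
      then show ?thesis
        using measure_sym_diff_UN[OF M(1) a(1), of b n] bs M(2) n(1) n\<delta> by simp
    qed
    moreover have "measure N (sym_diff (\<Union>i. a i) (\<Union>i<n. b i)) < \<epsilon>"
    proof -
      have "(\<Sum>i<n. measure N (sym_diff (a i) (b i))) \<le> real n * \<delta>"
        using sum_bounded_above[of "{..<n}" "\<lambda>i. measure N (sym_diff (a i) (b i))" \<delta>]
          less_imp_le[OF b(4)] by simp
      then show ?thesis
        using measure_sym_diff_UN[OF N(1) a(2), of b n] bs N(2) n(2) n\<delta> by simp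
    qed
    ultimately show ?case using b(1) by (intro exI[of _ "\<Union>i<n. L i"] exI[of _ "\<Union>i<n. b i"]) auto
  qed
  then show ?thesis using that by blast
qed

lemma measure_local_event:
  assumes "finite_measure M" "sets M = sets config_space" "finite \<Lambda>" "local_event \<Lambda> B"
  shows "measure M B = (\<Sum>\<eta>\<in>(\<lambda>\<sigma>. restrict \<sigma> \<Lambda>) ` B. measure M (cylinder \<Lambda> \<eta>))"
    and "finite ((\<lambda>\<sigma>. restrict \<sigma> \<Lambda>) ` B)"
proof -
  interpret finite_measure M by fact
  let ?H = "(\<lambda>\<sigma>. restrict \<sigma> \<Lambda>) ` B"
  have B: "B \<subseteq> space config_space" using assms(4) sets.sets_into_space unfolding local_event_def by blast
  then have "?H \<subseteq> (\<Pi>\<^sub>E v\<in>\<Lambda>. {-1, 1})" by (fastforce simp: space_config)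
  then show fin: "finite ?H" by (rule finite_subset) (simp add: finite_PiE assms(3))
  have "B = (\<Union>\<eta>\<in>?H. cylinder \<Lambda> \<eta>)"
  proof
    show "B \<subseteq> (\<Union>\<eta>\<in>?H. cylinder \<Lambda> \<eta>)" using B by (force simp: cylinder_def)
    show "(\<Union>\<eta>\<in>?H. cylinder \<Lambda> \<eta>) \<subseteq> B"
    proof clarify
      fix \<sigma> \<tau> assume "\<sigma> \<in> cylinder \<Lambda> (restrict \<tau> \<Lambda>)" "\<tau> \<in> B"
      then show "\<sigma> \<in> B" using assms(4) B unfolding local_event_def cylinder_def by auto
    qed
  qed
  moreover have "measure M (\<Union>\<eta>\<in>?H. cylinder \<Lambda> \<eta>) = (\<Sum>\<eta>\<in>?H. measure M (cylinder \<Lambda> \<eta>))"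
  proof (rule finite_measure_finite_Union[OF fin])
    show "cylinder \<Lambda> ` ?H \<subseteq> sets M"
      unfolding assms(2) using sets_cylinder[OF assms(3)] by blast
    show "disjoint_family_on (cylinder \<Lambda>) ?H"
      unfolding disjoint_family_on_def
    proof (intro ballI impI, rule ccontr)
      fix \<eta> \<eta>' assume H: "\<eta> \<in> ?H" "\<eta>' \<in> ?H" "\<eta> \<noteq> \<eta>'" "cylinder \<Lambda> \<eta> \<inter> cylinder \<Lambda> \<eta>' \<noteq> {}"
      then obtain \<sigma> where "\<sigma> \<in> cylinder \<Lambda> \<eta>" "\<sigma> \<in> cylinder \<Lambda> \<eta>'" by blast
      then have "\<eta> v = \<eta>' v" if "v \<in> \<Lambda>" for v using that by (simp add: cylinder_def)
      moreover have "\<eta> \<in> extensional \<Lambda>" "\<eta>' \<in> extensional \<Lambda>" using H(1,2) by auto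
      ultimately have "\<eta> = \<eta>'" by (metis extensionalityI)
      then show False using H(3) by simp
    qed
  qed
  ultimately show "measure M B = (\<Sum>\<eta>\<in>?H. measure M (cylinder \<Lambda> \<eta>))" by simp
qed

text \<open>A local event is a finite disjoint union of cylinders, so the bound passes to local
  events by summation and then to all events by approximation. With \<open>C = 1\<close> in both
  directions it identifies two laws; with larger \<open>C\<close> it bounds the effect of a
  flip.\<close>

lemma measure_le_of_cylinders:
  assumes M: "finite_measure M" "sets M = sets config_space"
    and N: "finite_measure N" "sets N = sets config_space"
    and "C \<ge> 0" and le: "\<And>\<Lambda> \<eta>. finite \<Lambda> \<Longrightarrow> measure M (cylinder \<Lambda> \<eta>) \<le> C * measure N (cylinder \<Lambda> \<eta>)"
    and A: "A \<in> sets config_space"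
  shows "measure M A \<le> C * measure N A"
proof (rule field_le_epsilon)
  fix e :: real assume "e > 0"
  interpret M: finite_measure M by fact
  interpret N: finite_measure N by fact
  define \<epsilon> where "\<epsilon> = e / (1 + C)"
  have "\<epsilon> > 0" using \<open>e > 0\<close> \<open>C \<ge> 0\<close> by (simp add: \<epsilon>_def)
  obtain \<Lambda> B where B: "finite \<Lambda>" "local_event \<Lambda> B"
    "measure M (sym_diff A B) < \<epsilon>" "measure N (sym_diff A B) < \<epsilon>"
    using approximate_by_local[OF M N A \<open>\<epsilon> > 0\<close>] .
  have Bs: "B \<in> sets config_space" using B(2) by (simp add: local_event_def)
  have "measure M A \<le> measure M (B \<union> sym_diff A B)"
    by (rule M.finite_measure_mono) (use A Bs M in auto)
  also have "\<dots> \<le> measure M B + measure M (sym_diff A B)"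
    by (rule measure_Un_le) (use A Bs M in auto)
  also have "measure M B \<le> C * measure N B"
    unfolding measure_local_event(1)[OF M B(1,2)] measure_local_event(1)[OF N B(1,2)] sum_distrib_left
    by (intro sum_mono le B(1))
  also have "measure N B \<le> measure N (A \<union> sym_diff A B)"
    by (rule N.finite_measure_mono) (use A Bs N in auto)
  also have "\<dots> \<le> measure N A + measure N (sym_diff A B)"
    by (rule measure_Un_le) (use A Bs N in auto)
  finally have "measure M A \<le> C * (measure N A + measure N (sym_diff A B)) + measure M (sym_diff A B)"
    using \<open>C \<ge> 0\<close> by (simp add: mult_left_mono)
  also have "\<dots> \<le> C * (measure N A + \<epsilon>) + \<epsilon>"
    using B(3,4) \<open>C \<ge> 0\<close> by (intro add_mono mult_left_mono) auto
  also have "\<dots> = C * measure N A + (1 + C) * \<epsilon>" by (simp add: algebra_simps)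
  also have "(1 + C) * \<epsilon> = e" using \<open>C \<ge> 0\<close> by (simp add: \<epsilon>_def)
  finally show "measure M A \<le> C * measure N A + e" .
qed

text \<open>The assumption \<open>flip_bound\<close> is finite energy in quantitative form: the
  image of \<open>P\<close> under a flip at one vertex has density at most \<open>C\<close> with
  respect to \<open>P\<close>, with the same \<open>C\<close> at every vertex.\<close>

locale stationary_spins = prob_space P for P :: "spin_config measure" +
  fixes C :: real
  assumes sets_P: "sets P = sets config_space"
    and translate_invariant: "\<And>z A. A \<in> sets config_space \<Longrightarrow>
      measure P (translate z -` A \<inter> space config_space) = measure P A"
    and flip_bound: "\<And>v A. A \<in> sets config_space \<Longrightarrow>
      measure P (flip {v} -` A \<inter> space config_space) \<le> C * measure P A"
begin

lemma space_P: "space P = space config_space"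
  using sets_P by (rule sets_eq_imp_space_eq)

lemma measurable_flip_P [measurable]: "flip S \<in> measurable P P"
  using measurable_flip by (simp add: sets_P cong: measurable_cong_sets)

text \<open>By \<open>flip_bound\<close> the image of \<open>P\<close> under a single flip is
  absolutely continuous, so null sets pull back to null sets; a finite flip is a composition of
  single ones.\<close>

lemma AE_flip:
  assumes "AE \<sigma> in P. Q \<sigma>" "finite S"
  shows "AE \<sigma> in P. Q (flip S \<sigma>)"
  using assms(2,1)
proof (induction S arbitrary: Q rule: finite_induct)
  case empty
  then show ?case by (simp add: flip_def)
next
  case (insert v S)
  have "AE \<sigma> in P. Q (flip S (flip {v} \<sigma>))"
  proof (rule AE_distrD[of "flip {v}" P P])
    show "AE \<sigma> in distr P P (flip {v}). Q (flip S \<sigma>)"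
    proof (rule absolutely_continuous_AE[of _ P])
      show "absolutely_continuous P (distr P P (flip {v}))"
        unfolding absolutely_continuous_def
      proof
        fix A assume A: "A \<in> null_sets P"
        then have As: "A \<in> sets config_space" "A \<in> sets P" and A0: "measure P A = 0"
          using sets_P by (auto simp: measure_eq_emeasure_eq_ennreal null_sets_def emeasure_eq_measure)
        have "measure P (flip {v} -` A \<inter> space P) \<le> 0"
          using flip_bound[OF As(1), of v] A0 by (simp add: space_P)
        then have "measure P (flip {v} -` A \<inter> space P) = 0" by (simp add: measure_le_0_iff)
        then show "A \<in> null_sets (distr P P (flip {v}))"
          using As(2) by (simp add: null_sets_def emeasure_distr emeasure_eq_measure)
      qed
    qed (use insert in simp_all)
  qed simp
  moreover have "flip S (flip {v} \<sigma>) = flip (insert v S) \<sigma>" for \<sigma>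
    using insert.hyps by (auto simp: flip_def)
  ultimately show ?case by simp
qed

text \<open>An invariant event is approximated by a local one, hence also by far away translates of it,
  and these do not see the spin at v.\<close>
lemma AE_invariant_flip_single:
  assumes A: "A \<in> sets config_space"
    and inv: "\<And>z. translate z -` A \<inter> space config_space = A"
  shows "AE \<sigma> in P. \<sigma> \<in> A \<longleftrightarrow> flip {v} \<sigma> \<in> A"
proof -
  let ?S = "space config_space"
  let ?F = "\<lambda>A. flip {v} -` A \<inter> ?S"
  have [measurable]: "?F X \<in> sets P" if "X \<in> sets config_space" for X
    using that measurable_flip sets_P by (simp add: measurable_sets)
  have C: "C \<ge> 0"
  proof -
    have "?F ?S = ?S" using flip_in_space by blast
    then have "1 \<le> C * 1" using flip_bound[of ?S v] prob_space by (simp add: space_P)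
    then show ?thesis by simp
  qed
  have "measure P (sym_diff A (?F A)) \<le> 0"
  proof (rule field_le_epsilon)
    fix e :: real assume "e > 0"
    \<comment> \<open>The approximation error is paid twice: once directly and once, multiplied by
      at most \<open>C\<close>, after the flip.\<close>
    define \<epsilon> where "\<epsilon> = e / (1 + C)"
    have "\<epsilon> > 0" using \<open>e > 0\<close> C by (simp add: \<epsilon>_def)
    have P: "finite_measure P" by unfold_locales
    obtain \<Lambda> B where B: "finite \<Lambda>" "local_event \<Lambda> B" "measure P (sym_diff A B) < \<epsilon>"
      using approximate_by_local[OF P sets_P P sets_P A \<open>\<epsilon> > 0\<close>] by metis
    have Bs: "B \<in> sets config_space" using B(2) by (simp add: local_event_def)
    obtain z where z: "z \<notin> (\<lambda>w. v - w) ` \<Lambda>"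
      using ex_new_if_finite[of "(\<lambda>w. v - w) ` \<Lambda>"] B(1) by (auto simp: infinite_UNIV_char_0 finite_prod)
    define B' where "B' = translate z -` B \<inter> ?S"
    have B's: "B' \<in> sets config_space"
      unfolding B'_def using Bs measurable_translate by (rule measurable_sets[rotated])
    have "sym_diff A B' = translate z -` sym_diff A B \<inter> ?S"
      using inv[of z] unfolding B'_def by blast
    then have AB': "measure P (sym_diff A B') < \<epsilon>"
      using translate_invariant[of "sym_diff A B" z] A Bs B(3) by simp
    have "?F B' = B'"
    proof -
      have "flip {v} \<sigma> \<in> B' \<longleftrightarrow> \<sigma> \<in> B'" if \<sigma>: "\<sigma> \<in> ?S" for \<sigma>
      proof -
        have "flip {v} \<sigma> \<in> ?S" using \<sigma> by (rule flip_in_space)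
        moreover have "translate z \<tau> \<in> ?S" if "\<tau> \<in> ?S" for \<tau>
          using that by (rule translate_in_space)
        moreover have "translate z (flip {v} \<sigma>) w = translate z \<sigma> w" if "w \<in> \<Lambda>" for w
        proof -
          have "w + z \<noteq> v" using z that by (force simp: algebra_simps)
          then show ?thesis by (simp add: translate_def flip_def)
        qed
        ultimately show ?thesis
          using B(2) \<sigma> unfolding local_event_def B'_def by blast
      qed
      then show ?thesis unfolding B'_def by blast
    qed
    \<comment> \<open>Since \<open>B'\<close> equals its own preimage under the flip, it can be
      inserted between \<open>A\<close> and \<open>?F A\<close>.\<close>
    then have "sym_diff A (?F A) \<subseteq> sym_diff A B' \<union> ?F (sym_diff A B')"
      using sets.sets_into_space[OF A] by blast
    then have "measure P (sym_diff A (?F A)) \<le> measure P (sym_diff A B' \<union> ?F (sym_diff A B'))"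
      by (rule finite_measure_mono) (use A B's sets_P in auto)
    also have "\<dots> \<le> measure P (sym_diff A B') + measure P (?F (sym_diff A B'))"
      by (rule measure_Un_le) (use A B's sets_P in auto)
    also have "\<dots> \<le> measure P (sym_diff A B') + C * measure P (sym_diff A B')"
      using flip_bound[of "sym_diff A B'" v] A B's by simp
    also have "\<dots> = (1 + C) * measure P (sym_diff A B')" by (simp add: algebra_simps)
    also have "\<dots> \<le> (1 + C) * \<epsilon>" using AB' C by (intro mult_left_mono) auto
    also have "\<dots> = e" using C by (simp add: \<epsilon>_def)
    finally show "measure P (sym_diff A (?F A)) \<le> 0 + e" by simp
  qed
  then have 0: "measure P (sym_diff A (?F A)) = 0" by (simp add: measure_le_0_iff)
  have "sym_diff A (?F A) \<in> null_sets P"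
    using 0 A sets_P by (simp add: null_sets_def emeasure_eq_measure)
  then show ?thesis
    by (rule AE_I') (auto simp: space_P)
qed

lemma AE_invariant_flip:
  assumes A: "A \<in> sets config_space"
    and inv: "\<And>z. translate z -` A \<inter> space config_space = A"
  shows "finite S \<Longrightarrow> AE \<sigma> in P. \<sigma> \<in> A \<longleftrightarrow> flip S \<sigma> \<in> A"
proof (induction S rule: finite_induct)
  case empty
  then show ?case by (simp add: flip_def)
next
  case (insert v S)
  have "flip S (flip {v} \<sigma>) = flip (insert v S) \<sigma>" for \<sigma>
    using insert.hyps by (auto simp: flip_def)
  then show ?case
    using AE_flip[OF insert.IH, of "{v}"] AE_invariant_flip_single[OF A inv, of v] by auto
qed

text \<open>The flip set used later depends on the configuration. There are only countably many
  finite sets of vertices, so one exceptional null set serves for all of them.\<close>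

lemma AE_all_flips:
  fixes Q :: "vertex set \<Rightarrow> spin_config \<Rightarrow> bool"
  assumes "\<And>S. finite S \<Longrightarrow> AE \<sigma> in P. Q S \<sigma>"
  shows "AE \<sigma> in P. \<forall>S. finite S \<longrightarrow> Q S \<sigma>"
proof -
  have "AE \<sigma> in P. \<forall>S\<in>{S. finite S}. Q S \<sigma>"
    by (subst AE_ball_countable[OF countable_Collect_finite]) (simp add: assms)
  then show ?thesis by simp
qed

end

section \<open>Tying contours together inside a box\<close>

definition edge_adj :: "(edge \<times> edge) set" where
  "edge_adj = {(e, f). dual_ends e \<inter> dual_ends f \<noteq> {}}"

definition square :: "int \<Rightarrow> vertex \<Rightarrow> vertex set" where
  "square m z = {fst z - m..fst z + m} \<times> {snd z - m..snd z + m}"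

definition touching :: "vertex set \<Rightarrow> edge set" where
  "touching B = {e. fst (edge_ends e) \<in> B \<or> snd (edge_ends e) \<in> B}"

lemma sym_edge_adj: "sym edge_adj"
  by (auto simp: edge_adj_def sym_def)

lemma edge_simps [simp]:
  "edge_ends ((x, y), True) = ((x, y), (x + 1, y))"
  "edge_ends ((x, y), False) = ((x, y), (x, y + 1))"
  "dual_ends ((x, y), True) = {(x, y - 1), (x, y)}"
  "dual_ends ((x, y), False) = {(x - 1, y), (x, y)}"
  by (simp_all add: edge_ends_def dual_ends_def)

lemma contour_of_eq: "contour_of \<sigma> e = cluster edge_adj (contour_edges \<sigma>) e"
proof -
  have "contour_adj \<sigma> = Restr edge_adj (contour_edges \<sigma>)"
    by (auto simp: contour_adj_def edge_adj_def)
  then show ?thesis by (simp add: contour_of_def cluster_def)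
qed

lemma in_contour_iff [simp]:
  "((x, y), True) \<in> contour_edges \<sigma> \<longleftrightarrow> \<sigma> (x, y) \<noteq> \<sigma> (x + 1, y)"
  "((x, y), False) \<in> contour_edges \<sigma> \<longleftrightarrow> \<sigma> (x, y) \<noteq> \<sigma> (x, y + 1)"
  by (simp_all add: contour_edges_def)

lemma finite_square [simp]: "finite (square m z)"
  by (simp add: square_def)

lemma finite_touching: "finite B \<Longrightarrow> finite (touching B)"
proof -
  assume "finite B"
  have "touching B \<subseteq> (\<lambda>(v, b). ((fst v, snd v), b)) ` (B \<times> UNIV)
      \<union> (\<lambda>v. ((fst v - 1, snd v), True)) ` B \<union> (\<lambda>v. ((fst v, snd v - 1), False)) ` B"
  proof
    fix e assume e: "e \<in> touching B"
    obtain x y b where [simp]: "e = ((x, y), b)" by (metis prod.exhaust)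
    show "e \<in> (\<lambda>(v, b). ((fst v, snd v), b)) ` (B \<times> UNIV)
      \<union> (\<lambda>v. ((fst v - 1, snd v), True)) ` B \<union> (\<lambda>v. ((fst v, snd v - 1), False)) ` B"
      using e by (cases b) (force simp: touching_def image_iff)+
  qed
  then show ?thesis by (rule finite_subset) (use \<open>finite B\<close> in auto)
qed

lemma edge_adj_near:
  assumes "(e, f) \<in> edge_adj"
  shows "\<bar>fst (fst e) - fst (fst f)\<bar> \<le> 1 \<and> \<bar>snd (fst e) - snd (fst f)\<bar> \<le> 1"
  using assms by (auto simp: edge_adj_def dual_ends_def split: prod.splits if_splits)

lemma finite_edge_adj: "finite {f. (e, f) \<in> edge_adj}"
proof -
  have "{f. (e, f) \<in> edge_adj} \<subseteq>
      ({fst (fst e) - 1..fst (fst e) + 1} \<times> {snd (fst e) - 1..snd (fst e) + 1}) \<times> UNIV"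
    using edge_adj_near by (fastforce simp: mem_Times_iff)
  then show ?thesis by (rule finite_subset) simp
qed

text \<open>Each of the four quadrants of the square carries a checkerboard, whose sign makes the corner
  spin differ from the spin just outside it.\<close>
definition patch :: "int \<Rightarrow> spin_config \<Rightarrow> spin_config" where
  "patch m \<sigma> = (\<lambda>(x, y). if (x, y) \<in> square m (0, 0)
     then (if even (x + y) then -1 else 1) *
        \<sigma> (if x \<le> 0 then - m else m, if y \<le> 0 then - m - 1 else m + 1)
     else \<sigma> (x, y))"

definition spins :: "spin_config set" where
  "spins = UNIV \<rightarrow> {-1, 1}"

lemma spins_cases: "\<sigma> \<in> spins \<Longrightarrow> \<sigma> v = -1 \<or> \<sigma> v = 1"
  by (auto simp: spins_def)

lemma square_0_iff: "(x, y) \<in> square m (0, 0) \<longleftrightarrow> -m \<le> x \<and> x \<le> m \<and> -m \<le> y \<and> y \<le> m"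
  by (auto simp: square_def)

lemma patch_spins: "\<sigma> \<in> spins \<Longrightarrow> patch m \<sigma> \<in> spins"
  by (auto simp: spins_def patch_def Pi_iff)

section \<open>The contours of the patched configuration\<close>

context
  fixes m :: int and \<sigma> \<tau> :: spin_config and W :: "edge set"
  assumes m: "m \<ge> 2" and \<sigma>: "\<sigma> \<in> spins"
  defines "\<tau> \<equiv> patch m \<sigma>" and "W \<equiv> contour_edges \<tau> \<inter> touching (square m (0, 0))"
begin

text \<open>Neighbours in one quadrant have opposite checkerboard signs. The conditions
  \<open>y \<noteq> 0\<close> and \<open>x \<noteq> 0\<close> exclude the edges across the seams,
  which lie between coordinates 0 and 1.\<close>

lemma patch_inner_edge:
  "\<lbrakk>-m \<le> x; x \<le> m; -m \<le> y; y < m; y \<noteq> 0\<rbrakk> \<Longrightarrow> ((x, y), False) \<in> W"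
  "\<lbrakk>-m \<le> x; x < m; -m \<le> y; y \<le> m; x \<noteq> 0\<rbrakk> \<Longrightarrow> ((x, y), True) \<in> W"
proof -
  have ne: "\<sigma> v \<noteq> 0" for v using spins_cases[OF \<sigma>, of v] by auto
  show "\<lbrakk>-m \<le> x; x \<le> m; -m \<le> y; y < m; y \<noteq> 0\<rbrakk> \<Longrightarrow> ((x, y), False) \<in> W"
    by (auto simp: W_def \<tau>_def patch_def square_0_iff touching_def ne)
  show "\<lbrakk>-m \<le> x; x < m; -m \<le> y; y \<le> m; x \<noteq> 0\<rbrakk> \<Longrightarrow> ((x, y), True) \<in> W"
    by (auto simp: W_def \<tau>_def patch_def square_0_iff touching_def ne)
qed

text \<open>Connectivity of \<open>W\<close> is traced through dual vertices, starting from a fixed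
  edge. Both ends of that edge, (1, 1) and (2, 1), lie in the same quadrant of the square because
  \<open>m \<ge> 2\<close>.\<close>

definition linked :: "vertex \<Rightarrow> bool" where
  "linked f \<longleftrightarrow> (\<exists>e\<in>cluster edge_adj W ((1, 1), True). f \<in> dual_ends e)"

lemma linked_edge:
  assumes "e \<in> W" "f \<in> dual_ends e" "linked f"
  shows "e \<in> cluster edge_adj W ((1, 1), True)"
proof -
  have "((1, 1), True) \<in> W" using m by (intro patch_inner_edge) auto
  then have sub: "cluster edge_adj W ((1, 1), True) \<subseteq> W" by (rule cluster_subset)
  obtain d where d: "d \<in> cluster edge_adj W ((1, 1), True)" "f \<in> dual_ends d"
    using assms(3) by (auto simp: linked_def)
  show ?thesis
    by (rule cluster_step[OF d(1)]) (use d assms sub in \<open>auto simp: edge_adj_def\<close>)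
qed

lemma linked_step: "e \<in> W \<Longrightarrow> f \<in> dual_ends e \<Longrightarrow> g \<in> dual_ends e \<Longrightarrow> linked f \<Longrightarrow> linked g"
  using linked_edge unfolding linked_def by blast

text \<open>A row of dual vertices is traversed by the duals of the vertical edges from height
  \<open>b\<close> to \<open>b + 1\<close>. For \<open>b \<noteq> 0\<close> each of these stays in
  one quadrant, so the row runs without a gap across the seam between left and right.\<close>

lemma linked_row:
  assumes "-m \<le> b" "b < m" "b \<noteq> 0" "-m - 1 \<le> a" "a \<le> m" "-m - 1 \<le> c" "c \<le> m" "linked (c, b)"
  shows "linked (a, b)"
proof -
  have up: "linked (a, b)" if "c \<le> a" "a \<le> m" "-m - 1 \<le> c" "linked (c, b)" for a c
    using that(1,2)
  proof (induction a rule: int_ge_induct)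
    case (step i)
    have "((i + 1, b), False) \<in> W" using step that assms by (intro patch_inner_edge) auto
    then show ?case by (rule linked_step[where f = "(i, b)"]) (use step in auto)
  qed (use that in simp)
  have down: "linked (a, b)" if "a \<le> c" "-m - 1 \<le> a" "c \<le> m" "linked (c, b)" for a c
    using that(1,2)
  proof (induction a rule: int_le_induct)
    case (step i)
    have "((i, b), False) \<in> W" using step that assms by (intro patch_inner_edge) auto
    then show ?case by (rule linked_step[where f = "(i, b)"]) (use step in auto)
  qed (use that in simp)
  show ?thesis using up[of c a] down[of a c] assms by (cases "c \<le> a") auto
qed

lemma linked_column:
  assumes "-m \<le> a" "a < m" "a \<noteq> 0" "-m - 1 \<le> b" "b \<le> m" "-m - 1 \<le> c" "c \<le> m" "linked (a, c)"
  shows "linked (a, b)"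
proof -
  have up: "linked (a, b)" if "c \<le> b" "b \<le> m" "-m - 1 \<le> c" "linked (a, c)" for b c
    using that(1,2)
  proof (induction b rule: int_ge_induct)
    case (step i)
    have "((a, i + 1), True) \<in> W" using step that assms by (intro patch_inner_edge) auto
    then show ?case by (rule linked_step[where f = "(a, i)"]) (use step in auto)
  qed (use that in simp)
  have down: "linked (a, b)" if "b \<le> c" "-m - 1 \<le> b" "c \<le> m" "linked (a, c)" for b c
    using that(1,2)
  proof (induction b rule: int_le_induct)
    case (step i)
    have "((a, i), True) \<in> W" using step that assms by (intro patch_inner_edge) auto
    then show ?case by (rule linked_step[where f = "(a, i)"]) (use step in auto)
  qed (use that in simp)
  show ?thesis using up[of c b] down[of b c] assms by (cases "c \<le> b") auto
qed

text \<open>Column 1 reaches every row, complete rows reach all columns, and complete columns then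
  fill the remaining rows. The nine excluded dual vertices are the four corners, the seam ends on
  the four sides and the centre; no edge inside a quadrant has a dual ending there.\<close>

lemma linked_face:
  assumes "-m - 1 \<le> a" "a \<le> m" "-m - 1 \<le> b" "b \<le> m"
    "a \<notin> {-m - 1, 0, m} \<or> b \<notin> {-m - 1, 0, m}"
  shows "linked (a, b)"
proof -
  have g11: "linked (1, 1)" unfolding linked_def by (rule bexI[OF _ cluster_self]) simp
  have col: "linked (1, b)" if "-m - 1 \<le> b" "b \<le> m" for b
    by (rule linked_column[where c = 1]) (use that m g11 in auto)
  have row: "linked (a, b)" if "-m - 1 \<le> a" "a \<le> m" "-m \<le> b" "b < m" "b \<noteq> 0" for a b
    by (rule linked_row[where c = 1]) (use that m col[of b] in auto)
  show ?thesis
  proof (cases "b \<in> {-m - 1, 0, m}")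
    case True
    show ?thesis
      by (rule linked_column[where c = 1]) (use True assms m row[of a 1] in auto)
  next
    case False
    then show ?thesis using assms by (intro row) auto
  qed
qed

text \<open>The ends of a dual edge differ by 1 in one coordinate. As \<open>m \<ge> 2\<close>, no
  two consecutive integers both belong to {-m - 1, 0, m}, so every edge of \<open>W\<close> has an
  end covered by \<open>linked_face\<close>.\<close>

lemma patch_touching_connected: "connected_in edge_adj W"
proof -
  have "W \<subseteq> cluster edge_adj W ((1, 1), True)"
  proof
    fix e assume e: "e \<in> W"
    obtain x y b where [simp]: "e = ((x, y), b)" by (metis prod.exhaust)
    have "\<exists>f\<in>dual_ends e. linked f"
    proof (cases b)
      case True
      then have "-m - 1 \<le> x" "x \<le> m" "-m \<le> y" "y \<le> m"
        using e by (auto simp: W_def touching_def square_0_iff)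
      then have "linked (x, y) \<or> linked (x, y - 1)"
        using m linked_face[of x "y - 1"] linked_face[of x y]
        by (cases "y \<in> {-m - 1, 0, m}") auto
      then show ?thesis using True by auto
    next
      case False
      then have "-m \<le> x" "x \<le> m" "-m - 1 \<le> y" "y \<le> m"
        using e by (auto simp: W_def touching_def square_0_iff)
      then have "linked (x, y) \<or> linked (x - 1, y)"
        using m linked_face[of "x - 1" y] linked_face[of x y]
        by (cases "x \<in> {-m - 1, 0, m}") auto
      then show ?thesis using False by auto
    qed
    then show "e \<in> cluster edge_adj W ((1, 1), True)" using linked_edge e by blast
  qed
  then have "W \<subseteq> cluster edge_adj W e" if "e \<in> W" for e
    using cluster_eq[OF sym_edge_adj, of e W "((1, 1), True)"] that by auto
  then show ?thesis by (simp add: connected_in_def)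
qed

text \<open>No outer contour that arrives at the box is lost. Only the nine exceptional dual
  vertices need an argument: the corners are caught by the signs of the quadrants, the seam ends by
  parity, and the centre is never reached from outside.\<close>

lemma patch_face_attached:
  assumes d: "d \<in> contour_edges \<tau> - touching (square m (0, 0))" and f: "f \<in> dual_ends d"
    and range: "f = (a, b)" "-m - 1 \<le> a" "a \<le> m" "-m - 1 \<le> b" "b \<le> m"
  shows "\<exists>w\<in>W. f \<in> dual_ends w"
proof (cases "a \<notin> {-m - 1, 0, m} \<or> b \<notin> {-m - 1, 0, m}")
  case True
  have "((1, 1), True) \<in> W" using m by (intro patch_inner_edge) auto
  then have "cluster edge_adj W ((1, 1), True) \<subseteq> W" by (rule cluster_subset)
  moreover obtain e where "e \<in> cluster edge_adj W ((1, 1), True)" "f \<in> dual_ends e"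
    using linked_face[OF range(2-5) True] unfolding linked_def range(1) by (elim bexE)
  ultimately show ?thesis by blast
next
  case False
  obtain x y c where [simp]: "d = ((x, y), c)" by (metis prod.exhaust)
  have ne: "\<sigma> v \<noteq> 0" for v using spins_cases[OF \<sigma>, of v] by auto
  have dval: "\<tau> v = -1 \<or> \<tau> v = 1" for v
    unfolding \<tau>_def by (rule spins_cases[OF patch_spins[OF \<sigma>]])
  \<comment> \<open>All four corner vertices have even coordinate sum, so \<open>patch\<close> gives
    each the negative of the spin just above or below it outside the square; the vertical edge
    leaving the corner is thus in \<open>W\<close>.\<close>
  have corner: ?thesis if "a \<noteq> 0" "b \<noteq> 0"
  proof -
    have ab: "a = -m - 1 \<or> a = m" "b = -m - 1 \<or> b = m" using False that by auto
    define x' where "x' = (if a = m then m else -m)"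
    have "((x', b), False) \<in> W"
      using ab m ne by (auto simp: W_def touching_def square_0_iff \<tau>_def patch_def x'_def) presburger
    moreover have "f \<in> dual_ends ((x', b), False)" using ab m by (auto simp: range x'_def)
    ultimately show ?thesis by blast
  qed
  have inner: ?thesis if "a = 0" "b = 0"
    using d f m that by (cases c) (auto simp: touching_def square_0_iff range)
  \<comment> \<open>Of the four primal edges round this dual vertex only the one outside the square
    can be \<open>d\<close>, and it joins different spins. Going round, the number of disagreements
    is even, so one of the other three edges, all touching the square, is a contour edge
    too.\<close>
  have vert: ?thesis if "a = 0" "b \<noteq> 0"
  proof -
    have b: "b = -m - 1 \<or> b = m" using False that by auto
    have "((0, b), False) \<in> touching (square m (0, 0))" "((1, b), False) \<in> touching (square m (0, 0))"
      "((0, if b = m then m else -m), True) \<in> touching (square m (0, 0))"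
      using b m by (auto simp: touching_def square_0_iff)
    moreover have "\<tau> (0, if b = m then m + 1 else b) \<noteq> \<tau> (1, if b = m then m + 1 else b)"
      using d f b m that by (cases c) (auto simp: touching_def square_0_iff range)
    ultimately have "((0, b), False) \<in> W \<or> ((1, b), False) \<in> W \<or> ((0, if b = m then m else -m), True) \<in> W"
      using b unfolding W_def by (auto split: if_splits)
    then show ?thesis using b that by (auto simp: range intro: bexI[rotated] split: if_splits)
  qed
  have horiz: ?thesis if "a \<noteq> 0" "b = 0"
  proof -
    have a: "a = -m - 1 \<or> a = m" using False that by auto
    have "((a, 0), True) \<in> touching (square m (0, 0))" "((a, 1), True) \<in> touching (square m (0, 0))"
      "((if a = m then m else -m, 0), False) \<in> touching (square m (0, 0))"
      using a m by (auto simp: touching_def square_0_iff)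
    moreover have "\<tau> (if a = m then m + 1 else a, 0) \<noteq> \<tau> (if a = m then m + 1 else a, 1)"
      using d f a m that by (cases c) (auto simp: touching_def square_0_iff range)
    ultimately have "((a, 0), True) \<in> W \<or> ((a, 1), True) \<in> W \<or> ((if a = m then m else -m, 0), False) \<in> W"
      using a unfolding W_def by (auto split: if_splits)
    then show ?thesis using a that by (auto simp: range intro: bexI[rotated] split: if_splits)
  qed
  show ?thesis using corner inner vert horiz by blast
qed

lemma patch_attached:
  assumes d: "d \<in> contour_edges \<tau> - touching (square m (0, 0))"
    and w: "w \<in> touching (square m (0, 0))" "(w, d) \<in> edge_adj"
  shows "\<exists>w'\<in>W. (w', d) \<in> edge_adj"
proof -
  obtain f where f: "f \<in> dual_ends w" "f \<in> dual_ends d" using w(2) by (auto simp: edge_adj_def)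
  obtain x y c where [simp]: "w = ((x, y), c)" by (metis prod.exhaust)
  obtain a b where [simp]: "f = (a, b)" by (cases f)
  have "-m - 1 \<le> a" "a \<le> m" "-m - 1 \<le> b" "b \<le> m"
    using w(1) f(1) by (cases c; auto simp: touching_def square_0_iff)+
  then show ?thesis using patch_face_attached[OF d f(2)] f(2) unfolding edge_adj_def by auto
qed

lemma patch_outer: "contour_edges \<tau> - touching (square m (0, 0)) = contour_edges \<sigma> - touching (square m (0, 0))"
proof -
  have out: "\<tau> v = \<sigma> v" if "v \<notin> square m (0, 0)" for v
    using that by (cases v) (auto simp: \<tau>_def patch_def)
  have "e \<in> contour_edges \<tau> \<longleftrightarrow> e \<in> contour_edges \<sigma>" if "e \<notin> touching (square m (0, 0))" for e
    using that by (simp add: contour_edges_def touching_def out)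
  then show ?thesis by blast
qed

end

abbreviation touched :: "spin_config \<Rightarrow> vertex set \<Rightarrow> edge set" where
  "touched \<sigma> B \<equiv> contour_edges \<sigma> \<inter> touching B"

lemma Diff_touched: "contour_edges \<sigma> - touched \<sigma> B = contour_edges \<sigma> - touching B"
  by blast

lemma square_covers:
  assumes "finite E"
  obtains m where "m \<ge> 2" "E \<subseteq> touching (square m (0, 0))"
proof -
  define h :: "edge \<Rightarrow> int" where "h e = \<bar>fst (fst e)\<bar> + \<bar>snd (fst e)\<bar>" for e
  define m where "m = 2 + sum h E"
  have "e \<in> touching (square m (0, 0))" if "e \<in> E" for e
  proof -
    have "h e \<le> sum h E" by (rule member_le_sum) (use that assms in \<open>auto simp: h_def\<close>)
    then have "fst (edge_ends e) \<in> square m (0, 0)"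
      by (cases e; cases "fst e") (auto simp: edge_ends_def square_0_iff h_def m_def)
    then show ?thesis by (simp add: touching_def)
  qed
  moreover have "m \<ge> 2" unfolding m_def by (auto simp: h_def intro!: sum_nonneg)
  ultimately show ?thesis using that by blast
qed

text \<open>Removing the finite set \<open>touching B\<close> splits the contour into components
  that border it. By local finiteness there are finitely many of these, so one is infinite. The edge
  \<open>w\<close> need not itself be a contour edge; \<open>patch_attached\<close> later replaces
  it by one of the patched configuration.\<close>

lemma infinite_outer_piece:
  assumes "finite B" "e \<in> touched \<sigma> B" and inf: "infinite (cluster edge_adj (contour_edges \<sigma>) e)"
  obtains d w where "d \<in> contour_edges \<sigma> - touching B" "d \<in> cluster edge_adj (contour_edges \<sigma>) e"
    "infinite (cluster edge_adj (contour_edges \<sigma> - touching B) d)"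
    "w \<in> touching B" "(w, d) \<in> edge_adj"
proof -
  let ?V = "contour_edges \<sigma>" and ?T = "touching B"
  define C where "C = cluster edge_adj ?V e"
  define N where "N = {d \<in> C - ?T. \<exists>w\<in>?T. (w, d) \<in> edge_adj}"
  have CV: "C \<subseteq> ?V" unfolding C_def using assms(2) by (intro cluster_subset) auto
  have "N \<subseteq> (\<Union>w\<in>?T. {d. (w, d) \<in> edge_adj})" by (auto simp: N_def)
  then have finN: "finite N"
    by (rule finite_subset) (use finite_touching[OF assms(1)] finite_edge_adj in auto)
  have "C \<subseteq> ?T \<union> (\<Union>d\<in>N. cluster edge_adj (?V - ?T) d)"
  proof
    fix f assume f: "f \<in> C"
    show "f \<in> ?T \<union> (\<Union>d\<in>N. cluster edge_adj (?V - ?T) d)"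
    proof (cases "f \<in> ?T")
      case False
      have Cf: "cluster edge_adj ?V f = C"
        using f cluster_eq[OF sym_edge_adj] unfolding C_def by blast
      then have "e \<in> cluster edge_adj ?V f" by (simp add: C_def)
      then obtain z w where zw: "z \<in> cluster edge_adj (?V - ?T) f" "w \<in> ?V \<inter> ?T" "(z, w) \<in> edge_adj"
        by (rule cluster_exit[where W = ?T]) (use assms(2) f CV False in auto)
      have "z \<in> C" using zw(1) cluster_mono[of "?V - ?T" ?V edge_adj f] unfolding Cf by blast
      moreover have "z \<notin> ?T" using zw(1) cluster_subset[of f "?V - ?T" edge_adj] f CV False by blast
      ultimately have "z \<in> N" using zw sym_edge_adj by (auto simp: N_def dest: symD)
      moreover have "f \<in> cluster edge_adj (?V - ?T) z"
        using cluster_eq[OF sym_edge_adj zw(1)] by simp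
      ultimately show ?thesis by blast
    qed simp
  qed
  then have "\<exists>d\<in>N. infinite (cluster edge_adj (?V - ?T) d)"
    using inf finN finite_touching[OF assms(1)] finite_subset
    unfolding C_def[symmetric] by (meson finite_UN_I finite_Un)
  then show ?thesis using that CV unfolding N_def C_def by blast
qed

text \<open>Each of the three contours keeps an infinite piece outside a box that touches all of
  them. The patch leaves these pieces unchanged and attaches them to the connected contour set that
  touches the box.\<close>

lemma trifurcation_patch:
  assumes \<sigma>: "\<sigma> \<in> spins"
    and C: "infinite_contour \<sigma> C1" "infinite_contour \<sigma> C2" "infinite_contour \<sigma> C3"
    and ne: "C1 \<noteq> C2" "C1 \<noteq> C3" "C2 \<noteq> C3"
  obtains m where "m \<ge> 2" "trifurcation edge_adj (contour_edges (patch m \<sigma>))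
    (touched (patch m \<sigma>) (square m (0, 0)))"
proof -
  let ?V = "contour_edges \<sigma>"
  obtain e1 e2 e3 where e: "C1 = cluster edge_adj ?V e1" "C2 = cluster edge_adj ?V e2"
    "C3 = cluster edge_adj ?V e3" "{e1, e2, e3} \<subseteq> ?V"
    using C unfolding infinite_contour_def contour_of_eq by (metis empty_subsetI insert_subset)
  obtain m where m: "m \<ge> 2" "{e1, e2, e3} \<subseteq> touching (square m (0, 0))"
    using square_covers[of "{e1, e2, e3}"] by auto
  let ?T = "touching (square m (0, 0))" and ?V' = "contour_edges (patch m \<sigma>)"
  have O: "?V' - ?T = ?V - ?T" by (rule patch_outer[OF m(1) \<sigma>])
  have piece: "\<exists>d. d \<in> ?V' - ?T \<and> d \<in> cluster edge_adj ?V e \<and> infinite (cluster edge_adj (?V' - ?T) d)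
      \<and> (\<exists>w'\<in>touched (patch m \<sigma>) (square m (0, 0)). (w', d) \<in> edge_adj)"
    if "e \<in> {e1, e2, e3}" for e
  proof -
    have "infinite (cluster edge_adj ?V e)"
      using that C e(1-3) by (auto simp: infinite_contour_def)
    moreover have "e \<in> touched \<sigma> (square m (0, 0))" using that e(4) m(2) by auto
    ultimately obtain d w where dw: "d \<in> ?V - ?T" "d \<in> cluster edge_adj ?V e"
      "infinite (cluster edge_adj (?V - ?T) d)" "w \<in> ?T" "(w, d) \<in> edge_adj"
      by (metis infinite_outer_piece finite_square)
    moreover have "\<exists>w'\<in>touched (patch m \<sigma>) (square m (0, 0)). (w', d) \<in> edge_adj"
      by (rule patch_attached[OF m(1) \<sigma> _ dw(4,5)]) (use dw O in simp)
    ultimately show ?thesis unfolding O by blast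
  qed
  \<comment> \<open>Outer pieces are parts of contours of the original \<open>\<sigma>\<close>, so
    pieces of different contours remain separated once the box is removed.\<close>
  have sep: "d' \<notin> cluster edge_adj (?V' - ?T) d"
    if "d \<in> cluster edge_adj ?V e" "d' \<in> cluster edge_adj ?V e'"
      "cluster edge_adj ?V e \<noteq> cluster edge_adj ?V e'" for d d' e e'
  proof
    assume "d' \<in> cluster edge_adj (?V' - ?T) d"
    then have "d' \<in> cluster edge_adj ?V d"
      unfolding O using cluster_mono[of "?V - ?T" ?V edge_adj d] by blast
    then show False using that cluster_eq[OF sym_edge_adj] by metis
  qed
  obtain d1 where d1: "d1 \<in> ?V' - ?T" "d1 \<in> cluster edge_adj ?V e1"
    "infinite (cluster edge_adj (?V' - ?T) d1)"
    "\<exists>w'\<in>touched (patch m \<sigma>) (square m (0, 0)). (w', d1) \<in> edge_adj"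
    using piece[OF insertI1] by (elim exE conjE)
  obtain d2 where d2: "d2 \<in> ?V' - ?T" "d2 \<in> cluster edge_adj ?V e2"
    "infinite (cluster edge_adj (?V' - ?T) d2)"
    "\<exists>w'\<in>touched (patch m \<sigma>) (square m (0, 0)). (w', d2) \<in> edge_adj"
    using piece[OF insertI2[OF insertI1]] by (elim exE conjE)
  obtain d3 where d3: "d3 \<in> ?V' - ?T" "d3 \<in> cluster edge_adj ?V e3"
    "infinite (cluster edge_adj (?V' - ?T) d3)"
    "\<exists>w'\<in>touched (patch m \<sigma>) (square m (0, 0)). (w', d3) \<in> edge_adj"
    using piece[OF insertI2[OF insertI2[OF insertI1]]] by (elim exE conjE)
  have s: "d2 \<notin> cluster edge_adj (?V' - ?T) d1" "d3 \<notin> cluster edge_adj (?V' - ?T) d1"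
    "d3 \<notin> cluster edge_adj (?V' - ?T) d2"
    using sep[OF d1(2) d2(2)] sep[OF d1(2) d3(2)] sep[OF d2(2) d3(2)] ne unfolding e by blast+
  have "connected_in edge_adj (touched (patch m \<sigma>) (square m (0, 0)))"
    by (rule patch_touching_connected[OF m(1) \<sigma>])
  moreover have "\<forall>d\<in>{d1, d2, d3}. d \<in> ?V' - ?T \<and>
      (\<exists>w\<in>touched (patch m \<sigma>) (square m (0, 0)). (w, d) \<in> edge_adj) \<and>
      infinite (cluster edge_adj (?V' - ?T) d)"
    using d1(1,3,4) d2(1,3,4) d3(1,3,4) by blast
  ultimately have "trifurcation edge_adj ?V' (touched (patch m \<sigma>) (square m (0, 0)))"
    unfolding trifurcation_def Diff_touched using s by iprover
  then show ?thesis by (rule that[OF m(1)])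
qed

text \<open>An infinite contour of the patched configuration that avoids the box would be part of an
  infinite contour of \<open>\<sigma>\<close>, which meets the box by assumption. Just before its
  entry that contour borders a touching edge, and \<open>patch_attached\<close> then ties it to the
  box after all. Hence all infinite contours contain the same connected set.\<close>

lemma at_most_one_patch:
  assumes \<sigma>: "\<sigma> \<in> spins" and m: "m \<ge> 2"
    and meet: "\<And>C. infinite_contour \<sigma> C \<Longrightarrow> C \<inter> touching (square m (0, 0)) \<noteq> {}"
  shows "at_most_one_infinite_contour (patch m \<sigma>)"
proof -
  let ?V = "contour_edges \<sigma>" and ?T = "touching (square m (0, 0))" and ?V' = "contour_edges (patch m \<sigma>)"
  let ?W = "touched (patch m \<sigma>) (square m (0, 0))"
  have O: "?V' - ?T = ?V - ?T" by (rule patch_outer[OF m(1) \<sigma>])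
  have conn: "connected_in edge_adj ?W" by (rule patch_touching_connected[OF m \<sigma>])
  have "\<exists>w\<in>?W. C = cluster edge_adj ?V' w" if C: "infinite_contour (patch m \<sigma>) C" for C
  proof (rule ccontr)
    assume contra: "\<not> ?thesis"
    obtain e where e: "e \<in> ?V'" "C = cluster edge_adj ?V' e" "infinite C"
      using C unfolding infinite_contour_def contour_of_eq by blast
    have disj: "C \<inter> ?W = {}" using contra cluster_eq[OF sym_edge_adj] e(2) by blast
    have CV': "C \<subseteq> ?V'" unfolding e(2) using e(1) by (rule cluster_subset)
    then have sub: "C \<subseteq> ?V' - ?T" using disj by blast
    then have eq: "cluster edge_adj (?V - ?T) e = C"
      unfolding O[symmetric] e(2) by (rule cluster_restrict) (auto simp: sym_edge_adj)
    have "C \<subseteq> cluster edge_adj ?V e" unfolding eq[symmetric] by (rule cluster_mono) blast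
    then have "infinite (cluster edge_adj ?V e)" using e(3) finite_subset by blast
    moreover have eC: "e \<in> C" by (simp add: e(2))
    then have eV: "e \<in> ?V - ?T" using sub O by blast
    ultimately have "infinite_contour \<sigma> (cluster edge_adj ?V e)"
      unfolding infinite_contour_def contour_of_eq by blast
    then obtain y where y: "y \<in> cluster edge_adj ?V e" "y \<in> ?T" using meet by blast
    obtain z w where zw: "z \<in> cluster edge_adj (?V - ?T) e" "w \<in> ?V \<inter> ?T" "(z, w) \<in> edge_adj"
      by (rule cluster_exit[OF y eV])
    have zC: "z \<in> C" using zw(1) eq by simp
    have "(w, z) \<in> edge_adj" using sym_edge_adj zw(3) by (rule symD)
    then obtain w' where w': "w' \<in> ?W" "(w', z) \<in> edge_adj"
      using patch_attached[OF m \<sigma>, of z w] zC sub zw(2) by blast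
    have "w' \<in> cluster edge_adj ?V' e"
      by (rule cluster_step[of z]) (use zC e(2) w' CV' sym_edge_adj in \<open>auto dest: symD\<close>)
    then show False using w'(1) disj e(2) by blast
  qed note * = this
  show ?thesis
    unfolding at_most_one_infinite_contour_def
  proof (intro allI impI)
    fix C D assume "infinite_contour (patch m \<sigma>) C" "infinite_contour (patch m \<sigma>) D"
    then obtain v w where vw: "v \<in> ?W" "w \<in> ?W" "C = cluster edge_adj ?V' v" "D = cluster edge_adj ?V' w"
      using * by metis
    have "?W \<subseteq> cluster edge_adj ?V' v"
      by (rule connected_subset_cluster[OF conn _ vw(1)]) blast
    then show "C = D" using vw cluster_eq[OF sym_edge_adj, of w ?V' v] by auto
  qed
qed

section \<open>Transport of clusters, trifurcations and contours under translation\<close>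

lemma cluster_image:
  assumes "bij f" "\<And>x y. (f x, f y) \<in> R \<longleftrightarrow> (x, y) \<in> R"
  shows "cluster R (f ` A) (f x) = f ` cluster R A x"
proof
  have "f y \<in> cluster R (f ` A) (f x)" if "y \<in> cluster R A x" for y
    using that
  proof (induction rule: cluster_induct)
    case (step y z)
    show ?case by (rule cluster_step[OF step.IH]) (use step assms(2) in auto)
  qed simp
  then show "f ` cluster R A x \<subseteq> cluster R (f ` A) (f x)" by blast
  show "cluster R (f ` A) (f x) \<subseteq> f ` cluster R A x"
  proof (rule cluster_subsetI)
    fix y z assume yz: "y \<in> f ` cluster R A x" "(y, z) \<in> R" "y \<in> f ` A" "z \<in> f ` A"
    obtain y' z' where y': "y = f y'" "y' \<in> cluster R A x" and z': "z = f z'" "z' \<in> A"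
      using yz(1,4) by blast
    have "y' \<in> A"
      using yz(3) inj_image_mem_iff[OF bij_is_inj[OF assms(1)]] unfolding y'(1) by simp
    moreover have "(y', z') \<in> R" using yz(2) assms(2) unfolding y'(1) z'(1) by simp
    ultimately have "z' \<in> cluster R A x" using cluster_step[OF y'(2)] z'(2) by simp
    then show "z \<in> f ` cluster R A x" unfolding z'(1) by (rule imageI)
  qed simp
qed

lemma trifurcation_image:
  assumes f: "bij f" "\<And>x y. (f x, f y) \<in> R \<longleftrightarrow> (x, y) \<in> R" and "trifurcation R V W"
  shows "trifurcation R (f ` V) (f ` W)"
proof -
  have inj: "inj f" using f(1) by (rule bij_is_inj)
  obtain d1 d2 d3 where d: "\<forall>d\<in>{d1, d2, d3}. d \<in> V - W \<and> (\<exists>w\<in>W. (w, d) \<in> R)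
          \<and> infinite (cluster R (V - W) d)"
        "d2 \<notin> cluster R (V - W) d1" "d3 \<notin> cluster R (V - W) d1"
        "d3 \<notin> cluster R (V - W) d2" and conn: "connected_in R W"
    using assms(3) unfolding trifurcation_def by blast
  have "connected_in R (f ` W)"
    using conn unfolding connected_in_def by (auto simp: cluster_image[OF f])
  moreover have "f ` V - f ` W = f ` (V - W)" using inj by (simp add: image_set_diff)
  moreover have "infinite (f ` C) \<longleftrightarrow> infinite C" for C
    using inj_on_subset[OF inj subset_UNIV] by (simp add: finite_image_iff)
  moreover have "f x \<in> f ` C \<longleftrightarrow> x \<in> C" for x C using inj by (rule inj_image_mem_iff)
  ultimately show ?thesis
    unfolding trifurcation_def
    by (intro conjI exI[of _ "f d1"] exI[of _ "f d2"] exI[of _ "f d3"])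
       (use d f(2) in \<open>auto simp: cluster_image[OF f]\<close>)
qed

definition shift_edge :: "vertex \<Rightarrow> edge \<Rightarrow> edge" where
  "shift_edge z e = (fst e + z, snd e)"

lemma bij_shift_edge: "bij (shift_edge z)"
  by (rule o_bij[of "shift_edge (- z)"]) (auto simp: shift_edge_def fun_eq_iff)

lemma edge_ends_shift:
  "edge_ends (shift_edge z e) = (fst (edge_ends e) + z, snd (edge_ends e) + z)"
  by (cases e; cases "fst e"; cases z) (auto simp: edge_ends_def shift_edge_def)

lemma dual_ends_shift: "dual_ends (shift_edge z e) = (\<lambda>v. v + z) ` dual_ends e"
  by (cases e; cases "fst e"; cases z) (auto simp: dual_ends_def shift_edge_def)

lemma edge_adj_shift: "(shift_edge z e, shift_edge z f) \<in> edge_adj \<longleftrightarrow> (e, f) \<in> edge_adj"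
proof -
  have "inj (\<lambda>v. v + z)" by (simp add: inj_def)
  then show ?thesis
    by (simp add: edge_adj_def dual_ends_shift image_Int[symmetric])
qed

lemma contour_edges_shift: "shift_edge z ` contour_edges (translate z \<sigma>) = contour_edges \<sigma>"
proof -
  have "e \<in> contour_edges (translate z \<sigma>) \<longleftrightarrow> shift_edge z e \<in> contour_edges \<sigma>" for e
    by (simp add: contour_edges_def edge_ends_shift translate_def)
  then have "contour_edges (translate z \<sigma>) = shift_edge z -` contour_edges \<sigma>" by blast
  then show ?thesis using bij_shift_edge by (metis bij_is_surj surj_image_vimage_eq)
qed

lemma touching_shift: "shift_edge z ` touching (square m (0, 0)) = touching (square m z)"
proof -
  have "v + z \<in> square m z \<longleftrightarrow> v \<in> square m (0, 0)" for v
    by (cases v; cases z) (auto simp: square_def)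
  then have "touching (square m (0, 0)) = shift_edge z -` touching (square m z)"
    by (auto simp: touching_def edge_ends_shift)
  then show ?thesis using bij_shift_edge by (metis bij_is_surj surj_image_vimage_eq)
qed

lemma trifurcation_shift:
  assumes "trifurcation edge_adj (contour_edges (translate z \<sigma>)) (touched (translate z \<sigma>) (square m (0, 0)))"
  shows "trifurcation edge_adj (contour_edges \<sigma>) (touched \<sigma> (square m z))"
proof -
  have "shift_edge z ` touched (translate z \<sigma>) (square m (0, 0)) = touched \<sigma> (square m z)"
    using image_Int[OF bij_is_inj[OF bij_shift_edge]]
    by (simp add: contour_edges_shift touching_shift)
  then show ?thesis
    using trifurcation_image[OF bij_shift_edge[of z] edge_adj_shift assms]
    unfolding contour_edges_shift by simp
qed

lemma at_most_one_shift:
  assumes "at_most_one_infinite_contour \<sigma>"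
  shows "at_most_one_infinite_contour (translate z \<sigma>)"
proof -
  have "infinite_contour \<sigma> (shift_edge z ` C)" if C: "infinite_contour (translate z \<sigma>) C" for C
  proof -
    obtain e where e: "e \<in> contour_edges (translate z \<sigma>)" "infinite C"
      "C = cluster edge_adj (contour_edges (translate z \<sigma>)) e"
      using C unfolding infinite_contour_def contour_of_eq by blast
    have "shift_edge z ` C = cluster edge_adj (contour_edges \<sigma>) (shift_edge z e)"
      using cluster_image[OF bij_shift_edge edge_adj_shift, of z "contour_edges (translate z \<sigma>)" e]
      by (simp add: e(3) contour_edges_shift)
    moreover have "shift_edge z e \<in> contour_edges \<sigma>" using e(1) contour_edges_shift[of z \<sigma>] by blast
    moreover have "infinite (shift_edge z ` C)"
      using e(2) inj_on_subset[OF bij_is_inj[OF bij_shift_edge] subset_UNIV] by (simp add: finite_image_iff)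
    ultimately show ?thesis unfolding infinite_contour_def contour_of_eq by blast
  qed
  then have "shift_edge z ` C = shift_edge z ` D"
    if "infinite_contour (translate z \<sigma>) C" "infinite_contour (translate z \<sigma>) D" for C D
    using that assms unfolding at_most_one_infinite_contour_def by blast
  then show ?thesis
    unfolding at_most_one_infinite_contour_def
    by (simp add: inj_image_eq_iff[OF bij_is_inj[OF bij_shift_edge]])
qed

section \<open>The torus limit and the XOR configuration\<close>

abbreviation torus :: "nat \<Rightarrow> vertex set" where
  "torus n \<equiv> {0..<int n} \<times> {0..<int n}"

definition wrap :: "nat \<Rightarrow> vertex \<Rightarrow> vertex" where
  "wrap n v = (fst v mod int n, snd v mod int n)"

lemma wrap_in_torus: "n > 0 \<Longrightarrow> wrap n v \<in> torus n"
  by (simp add: wrap_def)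

lemma wrap_of_torus: "v \<in> torus n \<Longrightarrow> wrap n v = v"
  by (cases v) (simp add: wrap_def)

lemma wrap_add_wrap: "wrap n (wrap n v + z) = wrap n (v + z)"
  by (simp add: wrap_def mod_add_left_eq)

lemma torus_weight_alt:
  "torus_weight Jh Jv n \<tau> = exp (\<Sum>v\<in>torus n.
      Jh * of_int (\<tau> v * \<tau> (wrap n (v + (1, 0)))) + Jv * of_int (\<tau> v * \<tau> (wrap n (v + (0, 1)))))"
  unfolding torus_weight_def
  by (intro arg_cong[where f = exp] sum.cong refl) (auto simp: wrap_def)

definition torus_partition :: "real \<Rightarrow> real \<Rightarrow> nat \<Rightarrow> real" where
  "torus_partition Jh Jv n = (\<Sum>\<tau>\<in>torus_configs n. torus_weight Jh Jv n \<tau>)"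

lemma torus_cyl_prob_alt:
  "torus_cyl_prob Jh Jv n \<Lambda> \<eta> =
     (\<Sum>\<tau>\<in>torus_configs n. if \<forall>v\<in>\<Lambda>. \<tau> (wrap n v) = \<eta> v then torus_weight Jh Jv n \<tau> else 0)
     / torus_partition Jh Jv n"
  by (simp add: torus_cyl_prob_def torus_partition_def wrap_def)

lemma torus_partition_nonneg: "torus_partition Jh Jv n \<ge> 0"
  unfolding torus_partition_def torus_weight_def by (intro sum_nonneg) simp

text \<open>The restriction to the torus keeps the default value outside it, as membership in
  \<open>torus_configs\<close> demands.\<close>

definition rotate_torus :: "nat \<Rightarrow> vertex \<Rightarrow> spin_config \<Rightarrow> spin_config" where
  "rotate_torus n z \<tau> = (\<lambda>v\<in>torus n. \<tau> (wrap n (v + z)))"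

lemma rotate_configs:
  assumes "n > 0" "\<tau> \<in> torus_configs n"
  shows "rotate_torus n z \<tau> \<in> torus_configs n"
proof -
  have "\<tau> (wrap n (v + z)) \<in> {-1, 1}" for v
    using PiE_mem[OF assms(2)[unfolded torus_configs_def] wrap_in_torus[OF assms(1)]] .
  then show ?thesis unfolding torus_configs_def rotate_torus_def by (intro restrict_PiE_iff[THEN iffD2]) blast
qed

lemma rotate_rotate:
  assumes "n > 0" "\<tau> \<in> torus_configs n"
  shows "rotate_torus n (- z) (rotate_torus n z \<tau>) = \<tau>"
proof
  fix v
  show "rotate_torus n (- z) (rotate_torus n z \<tau>) v = \<tau> v"
  proof (cases "v \<in> torus n")
    case True
    then show ?thesis
      by (simp add: rotate_torus_def wrap_in_torus[OF assms(1)] wrap_add_wrap wrap_of_torus)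
  next
    case False
    then show ?thesis
      using PiE_arb[OF assms(2)[unfolded torus_configs_def] False] by (auto simp: rotate_torus_def)
  qed
qed

lemma rotate_wrap: "n > 0 \<Longrightarrow> rotate_torus n z \<tau> (wrap n v) = \<tau> (wrap n (v + z))"
  by (simp add: rotate_torus_def wrap_in_torus wrap_add_wrap)

lemma torus_weight_rotate:
  assumes "n > 0"
  shows "torus_weight Jh Jv n (rotate_torus n z \<tau>) = torus_weight Jh Jv n \<tau>"
proof -
  let ?f = "\<lambda>\<tau> v. Jh * of_int (\<tau> v * \<tau> (wrap n (v + (1, 0)))) + Jv * of_int (\<tau> v * \<tau> (wrap n (v + (0, 1))))"
  note rot = rotate_wrap[OF assms, of z \<tau>]
  have w: "wrap n (wrap n (v + z) + u) = wrap n (v + u + z)" for v u :: vertex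
    by (simp only: wrap_add_wrap add.assoc add.commute[of z u])
  have "(\<Sum>v\<in>torus n. ?f (rotate_torus n z \<tau>) v) = (\<Sum>v\<in>torus n. ?f \<tau> v)"
  proof (rule sum.reindex_bij_witness[of _ "\<lambda>v. wrap n (v - z)" "\<lambda>v. wrap n (v + z)"])
    fix v assume v: "v \<in> torus n"
    show "wrap n (wrap n (v + z) - z) = v"
      using wrap_add_wrap[of n "v + z" "- z"] wrap_of_torus[OF v] by simp
    show "wrap n (wrap n (v - z) + z) = v"
      using wrap_add_wrap[of n "v - z" z] wrap_of_torus[OF v] by simp
    have "rotate_torus n z \<tau> v = \<tau> (wrap n (v + z))" using rot[of v] wrap_of_torus[OF v] by simp
    then show "?f \<tau> (wrap n (v + z)) = ?f (rotate_torus n z \<tau>) v" by (simp add: rot w)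
  qed (use assms in \<open>auto simp del: mem_Times_iff intro: wrap_in_torus\<close>)
  then show ?thesis by (simp add: torus_weight_alt)
qed

lemma torus_cyl_prob_translate:
  assumes "n > 0"
  shows "torus_cyl_prob Jh Jv n ((\<lambda>v. v + z) ` \<Lambda>) (\<lambda>v. \<eta> (v - z)) = torus_cyl_prob Jh Jv n \<Lambda> \<eta>"
proof -
  have "(\<Sum>\<tau>\<in>torus_configs n. if \<forall>v\<in>(\<lambda>v. v + z) ` \<Lambda>. \<tau> (wrap n v) = \<eta> (v - z) then torus_weight Jh Jv n \<tau> else 0) =
    (\<Sum>\<tau>\<in>torus_configs n. if \<forall>v\<in>\<Lambda>. \<tau> (wrap n v) = \<eta> v then torus_weight Jh Jv n \<tau> else 0)"
  proof (rule sum.reindex_bij_witness[of _ "rotate_torus n (- z)" "rotate_torus n z"])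
    fix \<tau> assume \<tau>: "\<tau> \<in> torus_configs n"
    show "rotate_torus n (- z) (rotate_torus n z \<tau>) = \<tau>" using assms \<tau> by (rule rotate_rotate)
    show "rotate_torus n z (rotate_torus n (- z) \<tau>) = \<tau>" using rotate_rotate[OF assms \<tau>, of "- z"] by simp
    show "(if \<forall>v\<in>\<Lambda>. rotate_torus n z \<tau> (wrap n v) = \<eta> v then torus_weight Jh Jv n (rotate_torus n z \<tau>) else 0) =
      (if \<forall>v\<in>(\<lambda>v. v + z) ` \<Lambda>. \<tau> (wrap n v) = \<eta> (v - z) then torus_weight Jh Jv n \<tau> else 0)"
      by (simp add: torus_weight_rotate[OF assms] rotate_wrap[OF assms])
  qed (use rotate_configs[OF assms] in auto)
  then show ?thesis by (simp only: torus_cyl_prob_alt)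
qed

lemma torus_spin_cases: "\<tau> \<in> torus_configs n \<Longrightarrow> v \<in> torus n \<Longrightarrow> \<tau> v = -1 \<or> \<tau> v = 1"
  unfolding torus_configs_def by (drule PiE_mem) auto

lemma flip_torus_configs: "\<tau> \<in> torus_configs n \<Longrightarrow> u \<in> torus n \<Longrightarrow> flip {u} \<tau> \<in> torus_configs n"
  unfolding torus_configs_def
  by (rule PiE_I) (auto simp: flip_def PiE_iff extensional_def)

text \<open>Each summand carries the edges to the right and upwards from its vertex. A flip at
  \<open>u\<close> therefore changes at most three summands, those of \<open>u\<close> and of its
  left and lower neighbours, each by at most \<open>2 * (Jh + Jv)\<close>.\<close>

lemma torus_weight_flip:
  assumes n: "n > 0" and u: "u \<in> torus n" and \<tau>: "\<tau> \<in> torus_configs n" and J: "Jh > 0" "Jv > 0"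
  shows "torus_weight Jh Jv n (flip {u} \<tau>) \<le> exp (6 * (Jh + Jv)) * torus_weight Jh Jv n \<tau>"
proof -
  define f where "f = (\<lambda>\<tau> v. Jh * of_int (\<tau> v * \<tau> (wrap n (v + (1, 0)))) + Jv * of_int (\<tau> v * \<tau> (wrap n (v + (0, 1)))) :: real)"
  define D where "D = {v \<in> torus n. v = u \<or> wrap n (v + (1, 0)) = u \<or> wrap n (v + (0, 1)) = u}"
  have abs: "\<bar>f \<tau> v\<bar> \<le> Jh + Jv" if "\<tau> \<in> torus_configs n" "v \<in> torus n" for \<tau> v
  proof -
    have prod: "real_of_int (\<tau> v * \<tau> (wrap n w)) = 1 \<or> real_of_int (\<tau> v * \<tau> (wrap n w)) = -1" for w
      using torus_spin_cases[OF that] torus_spin_cases[OF that(1) wrap_in_torus[OF n], of w] by auto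
    show ?thesis using prod[of "v + (1, 0)"] prod[of "v + (0, 1)"] J unfolding f_def
      by (auto simp del: of_int_mult)
  qed
  have le: "f (flip {u} \<tau>) v \<le> f \<tau> v + (if v \<in> D then 2 * (Jh + Jv) else 0)" if v: "v \<in> torus n" for v
  proof (cases "v \<in> D")
    case True
    then show ?thesis using abs[OF \<tau> v] abs[OF flip_torus_configs[OF \<tau> u] v] by simp
  next
    case False
    then have "v \<noteq> u" "wrap n (v + (1, 0)) \<noteq> u" "wrap n (v + (0, 1)) \<noteq> u" using v by (auto simp: D_def)
    then show ?thesis using False by (simp add: f_def flip_def)
  qed
  have "D \<subseteq> {u, wrap n (u - (1, 0)), wrap n (u - (0, 1))}"
  proof
    fix v assume v: "v \<in> D"
    have wr: "wrap n (wrap n (v + w) - w) = v" for w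
      using wrap_add_wrap[of n "v + w" "- w"] wrap_of_torus[of v n] v by (simp add: D_def)
    show "v \<in> {u, wrap n (u - (1, 0)), wrap n (u - (0, 1))}"
      using v wr[of "(1, 0)"] wr[of "(0, 1)"] by (auto simp: D_def)
  qed
  then have "card D \<le> card {u, wrap n (u - (1, 0)), wrap n (u - (0, 1))}" by (rule card_mono[rotated]) simp
  also have "\<dots> \<le> 3" by (simp add: card_insert_if)
  finally have D: "card D \<le> 3" .
  have "(\<Sum>v\<in>torus n. f (flip {u} \<tau>) v) \<le> (\<Sum>v\<in>torus n. f \<tau> v + (if v \<in> D then 2 * (Jh + Jv) else 0))"
    by (intro sum_mono le)
  also have "\<dots> = (\<Sum>v\<in>torus n. f \<tau> v) + real (card D) * (2 * (Jh + Jv))"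
  proof -
    have "D \<subseteq> torus n" by (auto simp: D_def)
    then have "torus n \<inter> D = D" by blast
    then show ?thesis by (simp add: sum.distrib sum.If_cases)
  qed
  also have "real (card D) * (2 * (Jh + Jv)) \<le> 3 * (2 * (Jh + Jv))"
    using D J by (intro mult_right_mono) auto
  finally have "(\<Sum>v\<in>torus n. f (flip {u} \<tau>) v) \<le> 6 * (Jh + Jv) + (\<Sum>v\<in>torus n. f \<tau> v)" by simp
  then show ?thesis unfolding torus_weight_alt f_def exp_add[symmetric] by simp
qed

text \<open>Flipping the torus spin at \<open>wrap n u\<close> matches flipping the prescribed spin
  at \<open>u\<close> only if no other vertex of \<open>\<Lambda>\<close> wraps to the same place.
  This holds for all large \<open>n\<close>, which is enough in the limit.\<close>

lemma torus_cyl_prob_flip: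
  assumes n: "n > 0" and J: "Jh > 0" "Jv > 0"
    and inj: "\<And>w. w \<in> \<Lambda> \<Longrightarrow> w \<noteq> u \<Longrightarrow> wrap n w \<noteq> wrap n u"
  shows "torus_cyl_prob Jh Jv n \<Lambda> (flip {u} \<eta>) \<le> exp (6 * (Jh + Jv)) * torus_cyl_prob Jh Jv n \<Lambda> \<eta>"
proof -
  let ?u = "wrap n u" and ?C = "exp (6 * (Jh + Jv))"
  have u: "?u \<in> torus n" using n by (rule wrap_in_torus)
  have flip_eq: "flip {?u} \<tau> (wrap n v) = flip {u} \<eta> v \<longleftrightarrow> \<tau> (wrap n v) = \<eta> v" if "v \<in> \<Lambda>" for \<tau> v
    using inj[OF that] by (cases "v = u") (auto simp: flip_def)
  have "(\<Sum>\<tau>\<in>torus_configs n. if \<forall>v\<in>\<Lambda>. \<tau> (wrap n v) = flip {u} \<eta> v then torus_weight Jh Jv n \<tau> else 0)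
    = (\<Sum>\<tau>\<in>torus_configs n. if \<forall>v\<in>\<Lambda>. \<tau> (wrap n v) = \<eta> v then torus_weight Jh Jv n (flip {?u} \<tau>) else 0)"
  proof (rule sum.reindex_bij_witness[of _ "flip {?u}" "flip {?u}"])
    fix \<tau>
    have ff: "flip {?u} (flip {?u} \<tau>) = \<tau>" for \<tau> by (auto simp: flip_def)
    show "flip {?u} (flip {?u} \<tau>) = \<tau>" "flip {?u} (flip {?u} \<tau>) = \<tau>" by (rule ff)+
    show "(if \<forall>v\<in>\<Lambda>. flip {?u} \<tau> (wrap n v) = \<eta> v then torus_weight Jh Jv n (flip {?u} (flip {?u} \<tau>)) else 0)
      = (if \<forall>v\<in>\<Lambda>. \<tau> (wrap n v) = flip {u} \<eta> v then torus_weight Jh Jv n \<tau> else 0)"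
      using flip_eq[of _ "flip {?u} \<tau>"] by (simp add: ff)
  qed (use flip_torus_configs[OF _ u] in auto)
  also have "\<dots> \<le> (\<Sum>\<tau>\<in>torus_configs n. ?C * (if \<forall>v\<in>\<Lambda>. \<tau> (wrap n v) = \<eta> v then torus_weight Jh Jv n \<tau> else 0))"
    using torus_weight_flip[OF n u _ J] by (intro sum_mono) auto
  finally show ?thesis
    unfolding torus_cyl_prob_alt sum_distrib_left[symmetric] times_divide_eq_right
    by (rule divide_right_mono[OF _ torus_partition_nonneg])
qed

lemma eventually_wrap_separates:
  assumes "finite \<Lambda>"
  shows "eventually (\<lambda>n. \<forall>w\<in>\<Lambda>. w \<noteq> u \<longrightarrow> wrap n w \<noteq> wrap n u) sequentially"
proof (rule eventually_ball_finite[OF assms], rule ballI)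
  fix w
  have "w = u" if n: "n > nat (\<bar>fst w - fst u\<bar> + \<bar>snd w - snd u\<bar>)" and eq: "wrap n w = wrap n u" for n
  proof -
    have "a = b" if "a mod int n = b mod int n" "\<bar>a - b\<bar> < int n" for a b
      using that dvd_imp_le_int[of "a - b" "int n"] by (auto simp: mod_eq_dvd_iff)
    then show ?thesis using n eq by (intro prod_eqI) (auto simp: wrap_def)
  qed
  then show "eventually (\<lambda>n. w \<noteq> u \<longrightarrow> wrap n w \<noteq> wrap n u) sequentially"
    by (intro eventually_mono[OF eventually_gt_at_top]) blast
qed

text \<open>Rotations preserve torus weights exactly and flips change them by a factor independent
  of \<open>n\<close>. Both facts survive in the limit for cylinders, and
  \<open>measure_le_of_cylinders\<close> extends them to all events.\<close>

lemma ising_stationary: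
  assumes J: "Jh > 0" "Jv > 0" and lim: "ising_infinite_volume_limit Jh Jv \<mu>"
  shows "stationary_spins \<mu> (exp (6 * (Jh + Jv)))"
proof -
  let ?C = "exp (6 * (Jh + Jv))"
  have s: "sets \<mu> = sets config_space" and "prob_space \<mu>"
    using lim by (auto simp: ising_infinite_volume_limit_def)
  then interpret prob_space \<mu> by blast
  have sp: "space \<mu> = space config_space" using s by (rule sets_eq_imp_space_eq)
  have cyl: "(\<lambda>n. torus_cyl_prob Jh Jv n \<Lambda> \<eta>) \<longlonglongrightarrow> measure \<mu> (cylinder \<Lambda> \<eta>)" if "finite \<Lambda>" for \<Lambda> \<eta>
    using lim that unfolding ising_infinite_volume_limit_def cylinder_def by blast
  have [measurable]: "translate z \<in> measurable \<mu> config_space" "flip S \<in> measurable \<mu> config_space" for z S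
    using measurable_translate measurable_flip by (simp_all add: s cong: measurable_cong_sets)
  have \<mu>: "finite_measure \<mu>" by unfold_locales
  show ?thesis
  proof
    show "sets \<mu> = sets config_space" by (rule s)
    fix z A assume A: "A \<in> sets config_space"
    let ?M = "distr \<mu> config_space (translate z)"
    have M: "finite_measure ?M" "sets ?M = sets config_space" by (auto intro!: finite_measure_distr)
    have eq: "measure ?M (cylinder \<Lambda> \<eta>) = measure \<mu> (cylinder \<Lambda> \<eta>)" if fin: "finite \<Lambda>" for \<Lambda> \<eta>
    proof -
      have "translate z -` cylinder \<Lambda> \<eta> \<inter> space \<mu> = cylinder ((\<lambda>v. v + z) ` \<Lambda>) (\<lambda>v. \<eta> (v - z))"
        by (auto simp: sp cylinder_def translate_apply translate_in_space)
      then have "measure ?M (cylinder \<Lambda> \<eta>) = measure \<mu> (cylinder ((\<lambda>v. v + z) ` \<Lambda>) (\<lambda>v. \<eta> (v - z)))"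
        using fin by (simp add: measure_distr sets_cylinder)
      moreover have "(\<lambda>n. torus_cyl_prob Jh Jv n \<Lambda> \<eta>) \<longlonglongrightarrow> measure \<mu> (cylinder ((\<lambda>v. v + z) ` \<Lambda>) (\<lambda>v. \<eta> (v - z)))"
      proof (rule Lim_transform_eventually[OF cyl])
        show "\<forall>\<^sub>F n in sequentially. torus_cyl_prob Jh Jv n ((\<lambda>v. v + z) ` \<Lambda>) (\<lambda>v. \<eta> (v - z)) = torus_cyl_prob Jh Jv n \<Lambda> \<eta>"
          using eventually_gt_at_top[of 0] by eventually_elim (rule torus_cyl_prob_translate)
      qed (use fin in simp)
      ultimately show ?thesis using LIMSEQ_unique[OF _ cyl[OF fin]] by simp
    qed
    have "measure ?M A \<le> 1 * measure \<mu> A" "measure \<mu> A \<le> 1 * measure ?M A"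
      by (rule measure_le_of_cylinders[OF M \<mu> s _ _ A] measure_le_of_cylinders[OF \<mu> s M _ _ A]; simp add: eq)+
    then show "measure \<mu> (translate z -` A \<inter> space config_space) = measure \<mu> A"
      using A by (simp add: measure_distr sp)
  next
    fix v A assume A: "A \<in> sets config_space"
    let ?M = "distr \<mu> config_space (flip {v})"
    have M: "finite_measure ?M" "sets ?M = sets config_space" by (auto intro!: finite_measure_distr)
    have le: "measure ?M (cylinder \<Lambda> \<eta>) \<le> ?C * measure \<mu> (cylinder \<Lambda> \<eta>)" if fin: "finite \<Lambda>" for \<Lambda> \<eta>
    proof -
      have *: "flip {v} \<sigma> w = \<eta> w \<longleftrightarrow> \<sigma> w = flip {v} \<eta> w" for \<sigma> w by (auto simp: flip_def)
      have "flip {v} -` cylinder \<Lambda> \<eta> \<inter> space \<mu> = cylinder \<Lambda> (flip {v} \<eta>)"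
        using flip_in_space by (auto simp: sp cylinder_def *)
      then have "measure ?M (cylinder \<Lambda> \<eta>) = measure \<mu> (cylinder \<Lambda> (flip {v} \<eta>))"
        using fin by (simp add: measure_distr sets_cylinder)
      also have "\<dots> \<le> ?C * measure \<mu> (cylinder \<Lambda> \<eta>)"
      proof (rule tendsto_le[OF _ tendsto_mult_left[OF cyl[OF fin]] cyl[OF fin]])
        show "\<forall>\<^sub>F n in sequentially. torus_cyl_prob Jh Jv n \<Lambda> (flip {v} \<eta>) \<le> ?C * torus_cyl_prob Jh Jv n \<Lambda> \<eta>"
          using eventually_gt_at_top[of 0] eventually_wrap_separates[OF fin, of v]
          by eventually_elim (intro torus_cyl_prob_flip J, auto)
      qed simp
      finally show ?thesis .
    qed
    have "measure ?M A \<le> ?C * measure \<mu> A"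
      by (rule measure_le_of_cylinders[OF M \<mu> s _ le A]) simp_all
    then show "measure \<mu> (flip {v} -` A \<inter> space config_space) \<le> ?C * measure \<mu> A"
      using A by (simp add: measure_distr sp)
  qed
qed

lemma measurable_xor [measurable]:
  "(\<lambda>\<omega>. xor_config (fst \<omega>) (snd \<omega>)) \<in> measurable (config_space \<Otimes>\<^sub>M config_space) config_space"
proof (subst (3) config_space_def, rule measurable_PiM_single')
  have spin: "(\<lambda>\<omega>. fst \<omega> v) \<in> measurable (config_space \<Otimes>\<^sub>M config_space) (count_space {-1, 1})"
    "(\<lambda>\<omega>. snd \<omega> v) \<in> measurable (config_space \<Otimes>\<^sub>M config_space) (count_space {-1, 1})" for v
    by (rule measurable_compose[OF _ measurable_spin], simp)+
  have m: "(\<lambda>(x, y). x * y) \<in> measurable (count_space {-1, 1 :: int} \<Otimes>\<^sub>M count_space {-1, 1 :: int}) (count_space {-1, 1})"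
    by (subst pair_measure_countable) (auto intro: countable_finite)
  show "(\<lambda>\<omega>. xor_config (fst \<omega>) (snd \<omega>) v) \<in> measurable (config_space \<Otimes>\<^sub>M config_space) (count_space {-1, 1})" for v
    using measurable_compose[OF measurable_Pair[OF spin] m] by (simp add: xor_config_def)
  show "(\<lambda>\<omega> v. xor_config (fst \<omega>) (snd \<omega>) v) \<in> space (config_space \<Otimes>\<^sub>M config_space) \<rightarrow> (\<Pi>\<^sub>E v\<in>UNIV. space (count_space {-1, 1}))"
  proof
    fix \<omega> assume "\<omega> \<in> space (config_space \<Otimes>\<^sub>M config_space)"
    then have "fst \<omega> v \<in> {-1, 1}" "snd \<omega> v \<in> {-1, 1}" for v
      by (auto simp: space_pair_measure space_config Pi_iff)
    moreover have "a * b \<in> {-1, 1}" if "a \<in> {-1, 1}" "b \<in> {-1, 1}" for a b :: int using that by auto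
    ultimately have "fst \<omega> v * snd \<omega> v \<in> {-1, 1}" for v by blast
    then show "(\<lambda>v. xor_config (fst \<omega>) (snd \<omega>) v) \<in> (\<Pi>\<^sub>E v\<in>UNIV. space (count_space {-1, 1}))"
      unfolding xor_config_def PiE_UNIV_domain by (intro Pi_I) simp
  qed
qed

text \<open>Translating both copies translates the product. A flip of the product is obtained by
  flipping the first copy alone, so the constant \<open>C\<close> is inherited by integrating over
  the second copy.\<close>

lemma xor_stationary:
  assumes "stationary_spins \<mu> C" "C \<ge> 0"
  shows "stationary_spins (distr (\<mu> \<Otimes>\<^sub>M \<mu>) config_space (\<lambda>\<omega>. xor_config (fst \<omega>) (snd \<omega>))) C"
proof -
  interpret stationary_spins \<mu> C by fact
  interpret pair: pair_prob_space \<mu> \<mu> by unfold_locales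
  let ?X = "\<lambda>\<omega>. xor_config (fst \<omega>) (snd \<omega>)"
  let ?P = "distr (\<mu> \<Otimes>\<^sub>M \<mu>) config_space ?X"
  have sets2: "sets (\<mu> \<Otimes>\<^sub>M \<mu>) = sets (config_space \<Otimes>\<^sub>M config_space)"
    by (intro sets_pair_measure_cong sets_P)
  have X [measurable]: "?X \<in> measurable (\<mu> \<Otimes>\<^sub>M \<mu>) config_space"
    using measurable_xor by (simp add: sets2 cong: measurable_cong_sets)
  have T [measurable]: "translate z \<in> measurable \<mu> \<mu>" for z
    using measurable_translate by (simp add: sets_P cong: measurable_cong_sets)
  have sp2: "space (\<mu> \<Otimes>\<^sub>M \<mu>) = space config_space \<times> space config_space"
    by (simp add: space_pair_measure space_P)
  show ?thesis
  proof (intro stationary_spins.intro stationary_spins_axioms.intro)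
    show "prob_space ?P" using X by (rule pair.prob_space_distr)
    show "sets ?P = sets config_space" by simp
    fix z A assume A: "A \<in> sets config_space"
    have dT: "distr \<mu> \<mu> (translate z) = \<mu>"
    proof (rule measure_eqI)
      fix B assume "B \<in> sets (distr \<mu> \<mu> (translate z))"
      then show "emeasure (distr \<mu> \<mu> (translate z)) B = emeasure \<mu> B"
        using translate_invariant[of B z] by (simp add: emeasure_distr emeasure_eq_measure space_P sets_P)
    qed simp
    let ?T = "\<lambda>(x, y). (translate z x, translate z y)"
    have "\<mu> \<Otimes>\<^sub>M \<mu> = distr (\<mu> \<Otimes>\<^sub>M \<mu>) (\<mu> \<Otimes>\<^sub>M \<mu>) ?T"
      using pair_measure_distr[OF T T, of z z] unfolding dT by (simp add: pair.sigma_finite_measure_axioms sigma_finite_measure_axioms)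
    then have "?P = distr (distr (\<mu> \<Otimes>\<^sub>M \<mu>) (\<mu> \<Otimes>\<^sub>M \<mu>) ?T) config_space ?X"
      by (rule arg_cong[where f = "\<lambda>M. distr M config_space ?X"])
    also have "\<dots> = distr (\<mu> \<Otimes>\<^sub>M \<mu>) config_space (?X \<circ> ?T)"
      by (intro distr_distr X) measurable
    also have "?X \<circ> ?T = translate z \<circ> ?X"
      by (auto simp: fun_eq_iff translate_def xor_config_def)
    also have "distr (\<mu> \<Otimes>\<^sub>M \<mu>) config_space (translate z \<circ> ?X) = distr ?P config_space (translate z)"
      by (intro distr_distr[symmetric] X measurable_translate)
    finally have "measure ?P A = measure (distr ?P config_space (translate z)) A"
      by (rule arg_cong[where f = "\<lambda>M. measure M A"])
    also have "\<dots> = measure ?P (translate z -` A \<inter> space ?P)"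
      by (rule measure_distr) (use A measurable_translate in \<open>simp_all cong: measurable_cong_sets\<close>)
    finally show "measure ?P (translate z -` A \<inter> space config_space) = measure ?P A" by simp
  next
    fix v A assume A: "A \<in> sets config_space"
    let ?F = "\<lambda>(x, y). (flip {v} x, y)"
    define X' where "X' = ?X -` A \<inter> space (\<mu> \<Otimes>\<^sub>M \<mu>)"
    have X': "X' \<in> sets (\<mu> \<Otimes>\<^sub>M \<mu>)" unfolding X'_def using X A by (rule measurable_sets)
    have "?F \<in> measurable (\<mu> \<Otimes>\<^sub>M \<mu>) (\<mu> \<Otimes>\<^sub>M \<mu>)" by measurable
    then have Y: "?F -` X' \<inter> space (\<mu> \<Otimes>\<^sub>M \<mu>) \<in> sets (\<mu> \<Otimes>\<^sub>M \<mu>)" using X' by (rule measurable_sets)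
    have "?X -` (flip {v} -` A \<inter> space config_space) \<inter> space (\<mu> \<Otimes>\<^sub>M \<mu>) = ?F -` X' \<inter> space (\<mu> \<Otimes>\<^sub>M \<mu>)"
    proof -
      have "xor_config (flip {v} x) y = flip {v} (xor_config x y)" for x y
        by (auto simp: fun_eq_iff flip_def xor_config_def)
      then show ?thesis
        using measurable_space[OF X] flip_in_space by (auto simp: X'_def sp2)
    qed
    then have "emeasure ?P (flip {v} -` A \<inter> space config_space) = emeasure (\<mu> \<Otimes>\<^sub>M \<mu>) (?F -` X' \<inter> space (\<mu> \<Otimes>\<^sub>M \<mu>))"
      using measurable_sets[OF measurable_flip A, of "{v}"] by (simp add: emeasure_distr)
    also have "\<dots> = (\<integral>\<^sup>+ y. emeasure \<mu> ((\<lambda>x. (x, y)) -` (?F -` X' \<inter> space (\<mu> \<Otimes>\<^sub>M \<mu>))) \<partial>\<mu>)"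
      by (rule pair.emeasure_pair_measure_alt2[OF Y])
    also have "\<dots> \<le> (\<integral>\<^sup>+ y. ennreal C * emeasure \<mu> ((\<lambda>x. (x, y)) -` X') \<partial>\<mu>)"
    proof (rule nn_integral_mono)
      fix y assume "y \<in> space \<mu>"
      then have "(\<lambda>x. (x, y)) -` (?F -` X' \<inter> space (\<mu> \<Otimes>\<^sub>M \<mu>)) = flip {v} -` ((\<lambda>x. (x, y)) -` X') \<inter> space config_space"
        by (auto simp: sp2 space_P)
      moreover have "(\<lambda>x. (x, y)) -` X' \<in> sets config_space"
        using sets_Pair2[OF X', of y] by (simp add: sets_P)
      ultimately show "emeasure \<mu> ((\<lambda>x. (x, y)) -` (?F -` X' \<inter> space (\<mu> \<Otimes>\<^sub>M \<mu>))) \<le> ennreal C * emeasure \<mu> ((\<lambda>x. (x, y)) -` X')"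
        using flip_bound[of "(\<lambda>x. (x, y)) -` X'" v] \<open>C \<ge> 0\<close>
        by (simp add: emeasure_eq_measure ennreal_mult[symmetric] ennreal_leI)
    qed
    also have "\<dots> = ennreal C * (\<integral>\<^sup>+ y. emeasure \<mu> ((\<lambda>x. (x, y)) -` X') \<partial>\<mu>)"
      by (rule nn_integral_cmult) (rule pair.measurable_emeasure_Pair2[OF X'])
    also have "(\<integral>\<^sup>+ y. emeasure \<mu> ((\<lambda>x. (x, y)) -` X') \<partial>\<mu>) = emeasure (\<mu> \<Otimes>\<^sub>M \<mu>) X'"
      by (rule pair.emeasure_pair_measure_alt2[OF X', symmetric])
    also have "emeasure (\<mu> \<Otimes>\<^sub>M \<mu>) X' = emeasure ?P A"
      using A by (simp add: emeasure_distr X'_def)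
    finally show "measure ?P (flip {v} -` A \<inter> space config_space) \<le> C * measure ?P A"
      using \<open>C \<ge> 0\<close> unfolding finite_measure.emeasure_eq_measure[OF prob_space.finite_measure[OF pair.prob_space_distr[OF X]]]
      by (simp add: ennreal_mult[symmetric])
  qed
qed

section \<open>Uniqueness of the infinite contour\<close>

lemma space_config_spins: "space config_space = spins"
  by (simp add: space_config spins_def)

text \<open>Writing the patch as a finite flip, with a set depending on \<open>\<sigma>\<close>,
  makes the almost sure statements about all finite flips applicable to it.\<close>

lemma patch_eq_flip:
  assumes "\<sigma> \<in> spins"
  obtains S where "finite S" "patch m \<sigma> = flip S \<sigma>"
proof
  let ?S = "{v \<in> square m (0, 0). patch m \<sigma> v \<noteq> \<sigma> v}"
  show "finite ?S" by simp
  show "patch m \<sigma> = flip ?S \<sigma>"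
  proof
    fix v
    have "patch m \<sigma> v = -1 \<or> patch m \<sigma> v = 1" "\<sigma> v = -1 \<or> \<sigma> v = 1"
      using spins_cases[OF assms] spins_cases[OF patch_spins[OF assms]] by blast+
    moreover have "v \<notin> square m (0, 0) \<Longrightarrow> patch m \<sigma> v = \<sigma> v"
      by (cases v) (simp add: patch_def)
    ultimately show "patch m \<sigma> v = flip ?S \<sigma> v" by (auto simp: flip_def)
  qed
qed

section \<open>Measurability of the events about clusters\<close>

lemma pred_cluster:
  fixes A :: "'b \<Rightarrow> 'a :: countable set"
  assumes "\<And>e. Measurable.pred M (\<lambda>\<sigma>. e \<in> A \<sigma>)"
  shows "Measurable.pred M (\<lambda>\<sigma>. f \<in> cluster R (A \<sigma>) e)"
proof -
  note assms [measurable]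
  have "Measurable.pred M (\<lambda>\<sigma>. (e, f) \<in> (Restr R (A \<sigma>)) ^^ n)" for n f
  proof (induction n arbitrary: f)
    case (Suc n)
    note Suc.IH [measurable]
    have eq: "(e, f) \<in> (Restr R (A \<sigma>)) ^^ Suc n \<longleftrightarrow>
        (\<exists>g. (e, g) \<in> (Restr R (A \<sigma>)) ^^ n \<and> (g, f) \<in> R \<and> g \<in> A \<sigma> \<and> f \<in> A \<sigma>)" for \<sigma>
      by auto
    show ?case unfolding eq by measurable
  qed simp
  note this [measurable]
  have "f \<in> cluster R (A \<sigma>) e \<longleftrightarrow> (\<exists>n. (e, f) \<in> (Restr R (A \<sigma>)) ^^ n)" for \<sigma>
    by (simp add: cluster_def rtrancl_power)
  then show ?thesis by simp
qed

text \<open>Infinity is expressed as unboundedness of the codes \<open>to_nat\<close>, which uses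
  only countable quantifiers.\<close>

lemma pred_infinite:
  fixes A :: "'b \<Rightarrow> 'a :: countable set"
  assumes [measurable]: "\<And>e. Measurable.pred M (\<lambda>\<sigma>. e \<in> A \<sigma>)"
  shows "Measurable.pred M (\<lambda>\<sigma>. infinite (A \<sigma>))"
proof -
  have "infinite B \<longleftrightarrow> (\<forall>k. \<exists>e. k < to_nat e \<and> e \<in> B)" for B :: "'a set"
  proof -
    have "infinite B \<longleftrightarrow> infinite (to_nat ` B)"
      by (simp add: finite_image_iff inj_on_subset[OF inj_to_nat subset_UNIV])
    also have "\<dots> \<longleftrightarrow> (\<forall>k. \<exists>e. k < to_nat e \<and> e \<in> B)"
      unfolding infinite_nat_iff_unbounded by blast
    finally show ?thesis .
  qed
  then show ?thesis by simp
qed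

lemma pred_trifurcation:
  fixes V W :: "'b \<Rightarrow> 'a :: countable set"
  assumes [measurable]: "\<And>e. Measurable.pred M (\<lambda>\<sigma>. e \<in> V \<sigma>)" "\<And>e. Measurable.pred M (\<lambda>\<sigma>. e \<in> W \<sigma>)"
  shows "Measurable.pred M (\<lambda>\<sigma>. trifurcation R (V \<sigma>) (W \<sigma>))"
proof -
  have [measurable]: "Measurable.pred M (\<lambda>\<sigma>. f \<in> cluster R (W \<sigma>) e)"
    "Measurable.pred M (\<lambda>\<sigma>. f \<in> cluster R (V \<sigma> - W \<sigma>) e)" for e f
    by (intro pred_cluster; simp)+
  have [measurable]: "Measurable.pred M (\<lambda>\<sigma>. infinite (cluster R (V \<sigma> - W \<sigma>) e))" for e
    by (intro pred_infinite) measurable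
  have conn: "connected_in R B \<longleftrightarrow> (\<forall>x y. x \<in> B \<longrightarrow> y \<in> B \<longrightarrow> y \<in> cluster R B x)" for B :: "'a set"
    by (auto simp: connected_in_def)
  have three: "(\<forall>d\<in>{a, b, c}. Q d) \<longleftrightarrow> Q a \<and> Q b \<and> Q c" for a b c :: 'a and Q
    by blast
  show ?thesis
    unfolding trifurcation_def conn three Bex_def Diff_iff by measurable
qed

lemma pred_contour_edge [measurable]: "Measurable.pred config_space (\<lambda>\<sigma>. e \<in> contour_edges \<sigma>)"
proof -
  have [measurable]: "(\<lambda>\<sigma>. \<sigma> v) \<in> measurable config_space (count_space UNIV)" for v
    using measurable_compose[OF measurable_spin[of v], of "\<lambda>x. x" "count_space UNIV"] by simp
  show ?thesis unfolding contour_edges_def by simp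
qed

text \<open>The definition quantifies over sets of edges, of which there are uncountably many; this
  form quantifies over edges only and is visibly measurable.\<close>

lemma at_most_one_iff:
  "at_most_one_infinite_contour \<sigma> \<longleftrightarrow> (\<forall>e f. e \<in> contour_edges \<sigma> \<longrightarrow> f \<in> contour_edges \<sigma> \<longrightarrow>
     infinite (cluster edge_adj (contour_edges \<sigma>) e) \<longrightarrow> infinite (cluster edge_adj (contour_edges \<sigma>) f) \<longrightarrow>
     f \<in> cluster edge_adj (contour_edges \<sigma>) e)"
proof -
  let ?K = "cluster edge_adj (contour_edges \<sigma>)"
  have "?K e = ?K f \<longleftrightarrow> f \<in> ?K e" for e f
  proof
    assume "?K e = ?K f"
    then show "f \<in> ?K e" by simp
  next
    assume "f \<in> ?K e"
    then show "?K e = ?K f" using cluster_eq[OF sym_edge_adj] by simp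
  qed
  then have "(\<forall>e f. e \<in> contour_edges \<sigma> \<longrightarrow> f \<in> contour_edges \<sigma> \<longrightarrow> infinite (?K e) \<longrightarrow>
      infinite (?K f) \<longrightarrow> f \<in> ?K e) \<longleftrightarrow> (\<forall>e f. e \<in> contour_edges \<sigma> \<longrightarrow>
      f \<in> contour_edges \<sigma> \<longrightarrow> infinite (?K e) \<longrightarrow> infinite (?K f) \<longrightarrow> ?K e = ?K f)"
    by (simp only:)
  then show ?thesis
    unfolding at_most_one_infinite_contour_def infinite_contour_def contour_of_eq by blast
qed

lemma pred_at_most_one: "Measurable.pred config_space at_most_one_infinite_contour"
proof -
  have [measurable]: "Measurable.pred config_space (\<lambda>\<sigma>. f \<in> cluster edge_adj (contour_edges \<sigma>) e)" for e f
    by (intro pred_cluster) measurable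
  have [measurable]: "Measurable.pred config_space (\<lambda>\<sigma>. infinite (cluster edge_adj (contour_edges \<sigma>) e))" for e
    by (intro pred_infinite) measurable
  show ?thesis unfolding at_most_one_iff[abs_def] by measurable
qed

section \<open>Trifurcations in a large box counted against its boundary\<close>

definition sup_norm :: "edge \<Rightarrow> int" where
  "sup_norm e = max \<bar>fst (fst e)\<bar> \<bar>snd (fst e)\<bar>"

lemma finite_sup_norm_le: "finite {e. sup_norm e \<le> L}"
proof -
  have "{e. sup_norm e \<le> L} \<subseteq> ({-L..L} \<times> {-L..L}) \<times> UNIV" by (auto simp: sup_norm_def)
  then show ?thesis by (rule finite_subset) simp
qed

text \<open>Four sides of \<open>2 * L + 1\<close> points with two edges per point give at most
  \<open>8 * (2 * L + 1)\<close>, which is at most \<open>24 * L\<close> for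
  \<open>L \<ge> 1\<close>.\<close>

lemma card_sup_norm_eq:
  assumes "L \<ge> 1"
  shows "card {e. sup_norm e = L} \<le> nat (24 * L)"
proof -
  let ?X = "({-L, L} \<times> {-L..L} \<union> {-L..L} \<times> {-L, L}) \<times> (UNIV :: bool set)"
  have "{e. sup_norm e = L} \<subseteq> ?X"
  proof
    fix e assume e: "e \<in> {e. sup_norm e = L}"
    obtain x y b where "e = ((x, y), b)" by (metis prod.exhaust)
    then show "e \<in> ?X" using e by (auto simp: sup_norm_def max_def split: if_splits)
  qed
  then have "card {e. sup_norm e = L} \<le> card ?X" by (rule card_mono[rotated]) simp
  also have "\<dots> = card ({-L, L} \<times> {-L..L} \<union> {-L..L} \<times> {-L, L}) * 2"
    by (simp add: card_cartesian_product)
  also have "\<dots> \<le> (card ({-L, L} \<times> {-L..L}) + card ({-L..L} \<times> {-L, L})) * 2"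
    by (intro mult_right_mono card_Un_le) simp
  also have "\<dots> = nat (2 * L + 1) * 8" using assms by (simp add: card_cartesian_product)
  also have "\<dots> \<le> nat (24 * L)" using assms by simp
  finally show ?thesis .
qed

text \<open>Adjacent edges differ by at most 1 in \<open>sup_norm\<close>, so a cluster starting at
  or below level \<open>L\<close> cannot jump over that level; avoiding it would confine the cluster
  to a finite set.\<close>

lemma infinite_cluster_crosses:
  assumes "infinite (cluster edge_adj A x)" "sup_norm x \<le> L"
  shows "cluster edge_adj A x \<inter> {e. sup_norm e = L} \<noteq> {}"
proof
  assume disj: "cluster edge_adj A x \<inter> {e. sup_norm e = L} = {}"
  have "sup_norm y < L" if "y \<in> cluster edge_adj A x" for y
    using that
  proof (induction rule: cluster_induct)
    case self
    have "x \<in> cluster edge_adj A x" by simp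
    then show ?case using disj assms(2) by (metis (mono_tags) disjoint_iff mem_Collect_eq order_less_le)
  next
    case (step y z)
    then have "z \<in> cluster edge_adj A x" by (blast intro: cluster_step)
    then have "sup_norm z \<noteq> L" using disj by blast
    moreover have "sup_norm z \<le> sup_norm y + 1"
      using edge_adj_near[OF \<open>(y, z) \<in> edge_adj\<close>] by (auto simp: sup_norm_def)
    ultimately show ?case using step.IH by linarith
  qed
  then have "cluster edge_adj A x \<subseteq> {e. sup_norm e \<le> L}" by force
  then show False using assms(1) finite_sup_norm_le finite_subset by blast
qed

definition grid :: "int \<Rightarrow> nat \<Rightarrow> vertex set" where
  "grid q n = (\<lambda>(i, j). (q * int i, q * int j)) ` ({..<n} \<times> {..<n})"

lemma card_grid: "q > 0 \<Longrightarrow> card (grid q n) = n * n"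
  unfolding grid_def by (subst card_image) (auto simp: inj_on_def)

text \<open>An edge is recorded by its left or lower end, which may lie one step outside the square.
  The base points thus span \<open>2 * m + 2\<close> values in each direction, the spacing that
  keeps the boxes centred at grid points disjoint.\<close>

lemma touching_square_near:
  assumes "e \<in> touching (square m z)"
  shows "fst z - m - 1 \<le> fst (fst e) \<and> fst (fst e) \<le> fst z + m \<and>
    snd z - m - 1 \<le> snd (fst e) \<and> snd (fst e) \<le> snd z + m"
  using assms
  by (cases e; cases "fst e"; cases "snd e") (auto simp: touching_def square_def)

lemma touching_grid_disjoint:
  assumes "z \<in> grid (2 * m + 2) n" "z' \<in> grid (2 * m + 2) n" "z \<noteq> z'" "m \<ge> 0"
  shows "touching (square m z) \<inter> touching (square m z') = {}"
proof (rule ccontr)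
  assume "\<not> ?thesis"
  then obtain e where e: "e \<in> touching (square m z)" "e \<in> touching (square m z')" by blast
  obtain i j i' j' where z: "z = ((2 * m + 2) * int i, (2 * m + 2) * int j)"
    "z' = ((2 * m + 2) * int i', (2 * m + 2) * int j')"
    using assms(1,2) unfolding grid_def by auto
  have eq: "k = k'" if "\<bar>(2 * m + 2) * int k - (2 * m + 2) * int k'\<bar> \<le> 2 * m + 1" for k k'
  proof (rule ccontr)
    assume "k \<noteq> k'"
    then have "1 \<le> \<bar>int k - int k'\<bar>" by simp
    then have "(2 * m + 2) * 1 \<le> (2 * m + 2) * \<bar>int k - int k'\<bar>"
      using assms(4) by (intro mult_left_mono) auto
    also have "\<dots> = \<bar>(2 * m + 2) * int k - (2 * m + 2) * int k'\<bar>"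
      using assms(4) by (simp add: abs_mult flip: right_diff_distrib)
    finally show False using that by simp
  qed
  have "i = i'" "j = j'"
    using touching_square_near[OF e(1)] touching_square_near[OF e(2)] unfolding z by (auto intro!: eq)
  then show False using z assms(3) by simp
qed

lemma card_grid_trifurcations:
  assumes "m \<ge> 0" "n \<ge> 1"
  shows "card {z \<in> grid (2 * m + 2) n. trifurcation edge_adj (contour_edges \<sigma>) (touched \<sigma> (square m z))}
    \<le> nat (24 * ((2 * m + 2) * int n))"
proof -
  let ?L = "(2 * m + 2) * int n"
  let ?T = "{z \<in> grid (2 * m + 2) n. trifurcation edge_adj (contour_edges \<sigma>) (touched \<sigma> (square m z))}"
  have L: "?L \<ge> 2 * m + 2" using assms mult_left_mono[of 1 "int n" "2 * m + 2"] by simp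
  have "card ?T \<le> card {e. sup_norm e = ?L}"
  proof (rule card_trifurcations_le[where R = edge_adj and V = "contour_edges \<sigma>" and W = "\<lambda>z. touched \<sigma> (square m z)"])
    show "finite ?T" by (simp add: grid_def)
    show "finite {e. sup_norm e = ?L}"
      by (rule finite_subset[OF _ finite_sup_norm_le[of ?L]]) auto
    show "touched \<sigma> (square m s) \<inter> touched \<sigma> (square m t) = {}" if "s \<in> ?T" "t \<in> ?T" "s \<noteq> t" for s t
      using touching_grid_disjoint[of s m n t] that assms(1) by blast
    show "cluster edge_adj A x \<inter> {e. sup_norm e = ?L} \<noteq> {}"
      if t: "t \<in> ?T" and that: "w \<in> touched \<sigma> (square m t)" "(w, x) \<in> edge_adj" "infinite (cluster edge_adj A x)" for A t w x
    proof (rule infinite_cluster_crosses[OF that(3)])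
      obtain i j where ij: "t = ((2 * m + 2) * int i, (2 * m + 2) * int j)" "i < n" "j < n"
        using t by (auto simp: grid_def)
      have k: "0 \<le> (2 * m + 2) * int k \<and> (2 * m + 2) * int k \<le> ?L - (2 * m + 2)" if "k < n" for k
      proof -
        have "(2 * m + 2) * (int k + 1) \<le> ?L" using that assms(1) by (intro mult_left_mono) auto
        then show ?thesis using assms(1) by (simp add: distrib_left)
      qed
      \<comment> \<open>Grid coordinates are at most \<open>?L - (2 * m + 2)\<close>; a touching
        edge adds at most \<open>m\<close>, an adjacent edge one more. On the other side the
        coordinates are at least \<open>-m - 2\<close>, still within \<open>?L\<close>.\<close>
      have "w \<in> touching (square m t)" using that(1) by blast
      then have "\<bar>fst (fst x)\<bar> \<le> ?L" "\<bar>snd (fst x)\<bar> \<le> ?L"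
        using edge_adj_near[OF that(2)] touching_square_near[of w m t] k[OF ij(2)] k[OF ij(3)] L assms(1)
        unfolding ij(1) fst_conv snd_conv by linarith+
      then show "sup_norm x \<le> ?L" by (simp add: sup_norm_def)
    qed
  qed (use sym_edge_adj in auto)
  also have "\<dots> \<le> nat (24 * ?L)" by (rule card_sup_norm_eq) (use L assms in linarith)
  finally show ?thesis .
qed

context stationary_spins
begin

text \<open>All \<open>n * n\<close> grid boxes are equally likely to be trifurcations, while their
  number never exceeds a multiple of \<open>n\<close>. Taking expectations and letting
  \<open>n\<close> grow forces probability zero.\<close>

lemma AE_no_trifurcation:
  assumes m: "m \<ge> 0"
  shows "AE \<sigma> in P. \<not> trifurcation edge_adj (contour_edges \<sigma>) (touched \<sigma> (square m (0, 0)))"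
proof -
  define E where "E = {\<sigma> \<in> space config_space. trifurcation edge_adj (contour_edges \<sigma>) (touched \<sigma> (square m (0, 0)))}"
  have [measurable]: "Measurable.pred config_space (\<lambda>\<sigma>. trifurcation edge_adj (contour_edges \<sigma>) (touched \<sigma> (square m (0, 0))))"
    by (rule pred_trifurcation) measurable
  have E: "E \<in> sets config_space" unfolding E_def by measurable
  define A where "A z = translate z -` E \<inter> space config_space" for z
  have A: "A z \<in> sets P" for z
    unfolding A_def sets_P using measurable_translate E by (rule measurable_sets)
  let ?q = "2 * m + 2"
  have bound: "real n * measure P E \<le> 24 * of_int ?q" if n: "n \<ge> 1" for n
  proof -
    let ?f = "\<lambda>\<sigma>. \<Sum>z\<in>grid ?q n. indicator (A z) \<sigma> :: real"
    have fin: "finite (grid ?q n)" by (simp add: grid_def)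
    have le: "?f \<sigma> \<le> 24 * of_int ?q * n" for \<sigma>
    proof -
      have f: "?f \<sigma> = real (card {z \<in> grid ?q n. \<sigma> \<in> A z})"
        using fin by (simp add: indicator_def sum.If_cases Int_def)
      have "{z \<in> grid ?q n. \<sigma> \<in> A z} \<subseteq>
        {z \<in> grid ?q n. trifurcation edge_adj (contour_edges \<sigma>) (touched \<sigma> (square m z))}"
        using trifurcation_shift unfolding A_def E_def by blast
      then have "card {z \<in> grid ?q n. \<sigma> \<in> A z} \<le>
        card {z \<in> grid ?q n. trifurcation edge_adj (contour_edges \<sigma>) (touched \<sigma> (square m z))}"
        by (rule card_mono[rotated]) (simp add: fin)
      also have "\<dots> \<le> nat (24 * (?q * int n))" by (rule card_grid_trifurcations[OF m n])
      finally have "card {z \<in> grid ?q n. \<sigma> \<in> A z} \<le> nat (24 * (?q * int n))" .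
      then have "real (card {z \<in> grid ?q n. \<sigma> \<in> A z}) \<le> real (nat (24 * (?q * int n)))" by simp
      also have "\<dots> = 24 * of_int ?q * n" using m by (subst of_nat_nat) auto
      finally show ?thesis unfolding f .
    qed
    have int: "integrable P (\<lambda>\<sigma>. indicator (A z) \<sigma> :: real)" for z
      using A by (intro integrable_real_indicator) (simp_all add: emeasure_eq_measure)
    have "real (n * n) * measure P E = (\<Sum>z\<in>grid ?q n. measure P (A z))"
      using translate_invariant[OF E] card_grid[of ?q n] m by (simp add: A_def)
    also have "\<dots> = (\<integral>\<sigma>. ?f \<sigma> \<partial>P)"
      using A int by (simp add: Bochner_Integration.integral_sum)
    also have "\<dots> \<le> 24 * of_int ?q * n"
      by (rule integral_le_const) (use int le in auto)
    finally have "real n * (real n * measure P E) \<le> real n * (24 * of_int ?q)" by (simp add: algebra_simps)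
    then show ?thesis using n by (simp add: mult_le_cancel_left_pos)
  qed
  have "measure P E = 0"
  proof (rule ccontr)
    assume "measure P E \<noteq> 0"
    then have pos: "measure P E > 0" by (simp add: zero_less_measure_iff)
    then obtain n where n: "real n * measure P E > 24 * of_int ?q"
      using reals_Archimedean3 by blast
    then show False using bound[of n] m by (cases "n = 0") auto
  qed
  then have "E \<in> null_sets P" using E sets_P by (simp add: null_sets_def emeasure_eq_measure)
  then show ?thesis by (rule AE_I') (auto simp: E_def space_P)
qed

lemma AE_at_most_one:
  "AE \<sigma> in P. at_most_one_infinite_contour \<sigma>"
proof -
  define A where "A = {\<sigma> \<in> space config_space. at_most_one_infinite_contour \<sigma>}"
  have A: "A \<in> sets config_space" unfolding A_def using pred_at_most_one by simp
  have inv: "translate z -` A \<inter> space config_space = A" for z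
  proof -
    have "translate (- z) (translate z \<sigma>) = \<sigma>" for \<sigma> by (simp add: translate_def)
    then have "at_most_one_infinite_contour (translate z \<sigma>) \<longleftrightarrow> at_most_one_infinite_contour \<sigma>" for \<sigma>
      using at_most_one_shift[of \<sigma> z] at_most_one_shift[of "translate z \<sigma>" "- z"] by auto
    then show ?thesis unfolding A_def using translate_in_space by blast
  qed
  \<comment> \<open>The flip set is chosen only after \<open>\<sigma>\<close> is known, so both
    almost sure statements are needed for all finite sets simultaneously.\<close>
  have 1: "AE \<sigma> in P. \<forall>S. finite S \<longrightarrow> (\<sigma> \<in> A \<longleftrightarrow> flip S \<sigma> \<in> A)"
    by (rule AE_all_flips) (rule AE_invariant_flip[OF A inv])
  have 2: "AE \<sigma> in P. \<forall>S. finite S \<longrightarrow> (\<forall>k::nat. \<not> trifurcation edge_adj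
      (contour_edges (flip S \<sigma>)) (touched (flip S \<sigma>) (square (int k) (0, 0))))"
    by (intro AE_all_flips AE_flip) (simp add: AE_all_countable AE_no_trifurcation)
  from 1 2 AE_space show ?thesis
  proof eventually_elim
    case (elim \<sigma>)
    have \<sigma>: "\<sigma> \<in> spins" using elim(3) by (simp add: space_P space_config_spins)
    show ?case
    proof (rule ccontr)
      assume not: "\<not> at_most_one_infinite_contour \<sigma>"
      then obtain C D where CD: "infinite_contour \<sigma> C" "infinite_contour \<sigma> D" "C \<noteq> D"
        unfolding at_most_one_infinite_contour_def by blast
      have two: "B = C \<or> B = D" if B: "infinite_contour \<sigma> B" for B
      proof (rule ccontr)
        assume "\<not> ?thesis"
        then have "C \<noteq> B" "D \<noteq> B" by auto
        then obtain m where m: "m \<ge> 2" "trifurcation edge_adj (contour_edges (patch m \<sigma>))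
            (touched (patch m \<sigma>) (square m (0, 0)))"
          using trifurcation_patch[OF \<sigma> CD(1,2) B CD(3)] by blast
        obtain S where "finite S" "patch m \<sigma> = flip S \<sigma>" using patch_eq_flip[OF \<sigma>] .
        then show False using elim(2)[rule_format, of S "nat m"] m by simp
      qed
      obtain e f where "e \<in> C" "f \<in> D"
        using CD(1,2) unfolding infinite_contour_def by (metis ex_in_conv finite.emptyI)
      obtain m where m: "m \<ge> 2" "{e, f} \<subseteq> touching (square m (0, 0))"
        using square_covers[of "{e, f}"] by auto
      \<comment> \<open>As \<open>C\<close> and \<open>D\<close> are the only infinite contours, a
        box touching one edge of each meets them all, as \<open>at_most_one_patch\<close>
        demands.\<close>
      have amo: "at_most_one_infinite_contour (patch m \<sigma>)"
        by (rule at_most_one_patch[OF \<sigma> m(1)]) (use two m(2) \<open>e \<in> C\<close> \<open>f \<in> D\<close> in blast)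
      obtain S where S: "finite S" "patch m \<sigma> = flip S \<sigma>" using patch_eq_flip[OF \<sigma>] .
      have "flip S \<sigma> \<in> A"
        using amo S(2) flip_in_space[of \<sigma> S] \<sigma> by (simp add: A_def space_config_spins)
      then show False using elim(1)[rule_format, OF S(1)] not by (simp add: A_def)
    qed
  qed
qed

end

theorem theorem1p9:
  fixes Jh Jv :: real and \<mu> :: "spin_config measure"
  assumes "Jh > 0" and "Jv > 0"
    and "exp (-2*Jh) + exp (-2*Jv) + exp (-2*Jh - 2*Jv) \<noteq> 1"
    and "ising_infinite_volume_limit Jh Jv \<mu>"
  shows "AE \<omega> in \<mu> \<Otimes>\<^sub>M \<mu>.
           at_most_one_infinite_contour (xor_config (fst \<omega>) (snd \<omega>))"
proof -
  have \<mu>: "stationary_spins \<mu> (exp (6 * (Jh + Jv)))"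
    using assms(1,2,4) by (rule ising_stationary)
  then have s: "sets \<mu> = sets config_space" by (rule stationary_spins.sets_P)
  have "sets (\<mu> \<Otimes>\<^sub>M \<mu>) = sets (config_space \<Otimes>\<^sub>M config_space)"
    by (intro sets_pair_measure_cong s)
  then have "(\<lambda>\<omega>. xor_config (fst \<omega>) (snd \<omega>)) \<in> measurable (\<mu> \<Otimes>\<^sub>M \<mu>) config_space"
    using measurable_xor by (simp cong: measurable_cong_sets)
  \<comment> \<open>The law of the XOR configuration is the image of the product law, so the almost
    sure statement pulls back to pairs of configurations.\<close>
  then show ?thesis
    using stationary_spins.AE_at_most_one[OF xor_stationary[OF \<mu>]] by (rule AE_distrD) simp
qed

end
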